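(* For almost all positive integers $m$ there exists a set $A\subset\mathbb{Z}_m$ with $(A-A)\cap R_m=\{0\}$ and $$|A|\geq \exp\left(0.375(\log\log m)^2(1+o(1))\right),$$ where $o(1)$ denotes a quantity depending only on $m$ and tending to $0$ as $m\to\infty$.
   Context: $\mathbb{Z}_m$ is the ring of integers modulo $m$; $R_m=\{a^2 : a\in\mathbb{Z}_m\}$ is the set of all squares in $\mathbb{Z}_m$ (including $0$ and squares that are not units); $A-A=\{a-b : a,b\in A\}$. "For almost all $m$" means for all $m$ in a set of density $1$, where the density of $M\subseteq\mathbb{N}$ is the lower asymptotic density $\liminf_{N\to\infty}\frac{\#(M\cap\{1,\dots,N\})}{N}$. Thus the claim is that there is a function $\delta(m)\to0$ such that the bound with $o(1)$ replaced by $\delta(m)$ holds for some such $A$, for all $m$ in a set of density $1$. *)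

theory Defs
  imports "HOL-Number_Theory.Residues" "HOL-Library.Extended_Real"
begin

(* The ring of integers modulo m, with carrier the representatives 0, ..., m - 1. For m = 1 the
   library record has a unit outside its carrier, but only addition, multiplication, negation and
   zero are used below, and these are correct for every m >= 1. *)
abbreviation Zmod :: "nat \<Rightarrow> int ring"
  where "Zmod m \<equiv> residue_ring (int m)"

(* All squares of the ring, 0 and non-units included (unlike quadratic residues in the narrow
   sense). *)
definition squares_mod :: "nat \<Rightarrow> int set"
  where "squares_mod m = {a \<otimes>\<^bsub>Zmod m\<^esub> a | a. a \<in> carrier (Zmod m)}"

definition diff_set :: "nat \<Rightarrow> int set \<Rightarrow> int set"
  where "diff_set m A = {a \<ominus>\<^bsub>Zmod m\<^esub> b | a b. a \<in> A \<and> b \<in> A}"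

definition lower_density :: "nat set \<Rightarrow> ereal"
  where "lower_density M = liminf (\<lambda>N. ereal (real (card (M \<inter> {1..N})) / real N))"

definition for_almost_all :: "(nat \<Rightarrow> bool) \<Rightarrow> bool"
  where "for_almost_all P \<longleftrightarrow> (\<exists>M \<subseteq> {1..}. lower_density M = 1 \<and> (\<forall>m\<in>M. P m))"

end

theory Submission
  imports Defs "HOL-Number_Theory.Number_Theory" "HOL-Real_Asymp.Real_Asymp"
    "HOL-Analysis.Summation_Tests"
begin

text \<open>
A set of residues modulo \<open>m\<close> with no non-zero square among its differences is assembled from the
odd prime divisors of \<open>m\<close>: by the Chinese remainder theorem, a difference is a non-square modulo
\<open>m\<close> as soon as it is one modulo a single prime divisor
(\<open>nonsquare_diffs_of_card_mult\<close>, \<open>nonsquare_diffs_of_card_dvd\<close>).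

Modulo a prime \<open>p\<close>, a Ramsey argument yields a sequence of about \<open>log 4 p\<close> residues in which every
earlier term minus every later term is a non-square (\<open>nonresidue_chain\<close>). If \<open>p\<close> is congruent to
\<open>1\<close> modulo \<open>4\<close>, then \<open>-1\<close> is a square and the terms form a set with non-square differences in both
directions. If \<open>p\<close> and \<open>q\<close> are congruent to \<open>3\<close>, a chain modulo \<open>p\<close> is paired with a
reversed chain modulo \<open>q\<close>, so a pair of such primes contributes as much as its smaller member
alone would (\<open>nonsquare_diffs_two_primes\<close>). Pairing neighbours in the sorted list of these
primes loses only one term, and altogether the logarithm of the size of the set is at least
\<open>weight m - ln (ln m) / 2\<close>, where \<open>weight m\<close> is essentially the sum of \<open>ln (ln p)\<close> over the
large prime divisors \<open>p\<close> of \<open>m\<close>, with factor \<open>1\<close> for the first class and \<open>1 / 2\<close> for the second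
(\<open>nonsquare_diffs_weight\<close>).

It remains to see that \<open>weight m\<close> is at least \<open>(3 / 8 + o(1)) * (ln (ln m))\<^sup>2\<close> for almost all \<open>m\<close>.
The function is additive, so its mean value up to \<open>N\<close> is close to the sum of
\<open>(3 + chi4 p) / 4 * ln (ln p) / p\<close> over the large primes up to \<open>N\<close>, where \<open>chi4\<close> is the non-trivial
character modulo \<open>4\<close>. Elementary estimates in the style of Chebyshev and Mertens show that the
second class cannot outweigh the first by more than a bounded amount, so the sum is at least
\<open>3 / 4 * (ln (ln N))\<^sup>2 / 2\<close> up to lower order terms (\<open>mean_weight_ge\<close>). Finally, the Turan-Kubilius inequality (\<open>turan_kubilius\<close>) bounds the
variance by a multiple of \<open>ln (ln N)\<close> times the mean, and Chebyshev's inequality shows that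
\<open>weight\<close> is rarely much smaller than its mean (\<open>card_small_weight\<close>).
\<close>

section \<open>Chains with non-square differences\<close>

text \<open>
A directed form of the Erdos-Szekeres bound. \<open>R\<close> need not be symmetric, because only pairs in
list order are compared: a first vertex splits the others by the relation it has to them, one
of the two classes has at least \<open>2 ^ (a + b - 1)\<close> elements, and the vertex goes in front of the
list found there, unless that list already has the required length in the other colour.
\<close>

lemma monochromatic_chain:
  fixes V :: "'a set"
  assumes "finite V" "2 ^ (a + b) \<le> card V"
  shows "\<exists>xs. set xs \<subseteq> V \<and> distinct xs \<and>
    (length xs = a \<and> sorted_wrt R xs \<or> length xs = b \<and> sorted_wrt (\<lambda>x y. \<not> R x y) xs)"
  using assms
proof (induction "a + b" arbitrary: a b V rule: less_induct)
  case less
  show ?case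
  proof (cases "a = 0 \<or> b = 0")
    case True
    thus ?thesis by (intro exI[of _ "[]"]) auto
  next
    case False
    then obtain a' b' where ab: "a = Suc a'" "b = Suc b'" by (metis not0_implies_Suc)
    have "card V > 0" using less.prems(2) by (meson less_le_trans zero_less_numeral zero_less_power)
    then obtain v where v: "v \<in> V" by fastforce
    define V1 where "V1 = {u \<in> V - {v}. R v u}"
    define V2 where "V2 = {u \<in> V - {v}. \<not> R v u}"
    have fin: "finite V1" "finite V2" using less.prems by (auto simp: V1_def V2_def)
    have "card V = Suc (card (V - {v}))" using v less.prems by (meson card.remove)
    also have "V - {v} = V1 \<union> V2" by (auto simp: V1_def V2_def)
    also have "card (V1 \<union> V2) = card V1 + card V2"
      using fin by (intro card_Un_disjoint) (auto simp: V1_def V2_def)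
    finally have c: "card V = Suc (card V1 + card V2)" .
    have "(2::nat) ^ (a + b) = 2 ^ (a' + b) + 2 ^ (a + b')" by (simp add: ab)
    hence "2 ^ (a' + b) \<le> card V1 \<or> 2 ^ (a + b') \<le> card V2" using c less.prems(2) by linarith
    thus ?thesis
    proof
      assume "2 ^ (a' + b) \<le> card V1"
      then obtain xs where xs: "set xs \<subseteq> V1" "distinct xs"
        "length xs = a' \<and> sorted_wrt R xs \<or> length xs = b \<and> sorted_wrt (\<lambda>x y. \<not> R x y) xs"
        using less.hyps[of a' b V1] fin ab by auto
      show ?thesis
        using xs v by (cases "length xs = b \<and> sorted_wrt (\<lambda>x y. \<not> R x y) xs",
          intro exI[of _ xs], force simp: V1_def, intro exI[of _ "v # xs"], auto simp: V1_def ab)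
    next
      assume "2 ^ (a + b') \<le> card V2"
      then obtain xs where xs: "set xs \<subseteq> V2" "distinct xs"
        "length xs = a \<and> sorted_wrt R xs \<or> length xs = b' \<and> sorted_wrt (\<lambda>x y. \<not> R x y) xs"
        using less.hyps[of a b' V2] fin ab by auto
      show ?thesis
        using xs v by (cases "length xs = a \<and> sorted_wrt R xs",
          intro exI[of _ xs], force simp: V2_def, intro exI[of _ "v # xs"], auto simp: V2_def ab)
    qed
  qed
qed

lemma QuadRes_0: "QuadRes m 0"
  unfolding QuadRes_def by (intro exI[of _ 0]) auto

lemma QuadRes_cong: "[a = b] (mod m) \<Longrightarrow> QuadRes m a \<longleftrightarrow> QuadRes m b"
  unfolding QuadRes_def by (meson cong_sym cong_trans)

lemma QuadRes_dvd_modulus: "QuadRes n a \<Longrightarrow> d dvd n \<Longrightarrow> QuadRes d a"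
  unfolding QuadRes_def by (meson cong_dvd_modulus)

text \<open>
If every residue were a square, squaring would permute the residues, yet \<open>1\<close> and \<open>-1\<close> have the
same square.
\<close>

lemma nonresidue_exists:
  assumes "prime p" "odd (p :: nat)"
  obtains c where "\<not> QuadRes (int p) c"
proof (rule ccontr)
  assume "\<not> thesis"
  with that have all: "QuadRes (int p) c" for c by blast
  have p2: "p > 2" using assms by (metis even_numeral nat_less_le prime_ge_2_nat)
  define f where "f = (\<lambda>x. x ^ 2 mod int p)"
  have "{0..<int p} \<subseteq> f ` {0..<int p}"
  proof
    fix c assume c: "c \<in> {0..<int p}"
    obtain y where "[y ^ 2 = c] (mod int p)" using all[of c] unfolding QuadRes_def by blast
    hence "c = f (y mod int p)" using c by (auto simp: f_def Cong.cong_def power_mod)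
    moreover have "y mod int p \<in> {0..<int p}" using p2 by simp
    ultimately show "c \<in> f ` {0..<int p}" by blast
  qed
  hence "inj_on f {0..<int p}"
    by (intro finite_surj_inj) auto
  moreover have "f 1 = f (int p - 1)"
  proof -
    have "(int p - 1) ^ 2 = 1 + int p * (int p - 2)" by (simp add: power2_eq_square algebra_simps)
    thus ?thesis by (simp add: f_def)
  qed
  ultimately have "1 = int p - 1" using p2 by (auto dest!: inj_onD[where x = 1])
  thus False using p2 by simp
qed

lemma nonresidue_times_residue:
  assumes "prime p" "\<not> QuadRes (int p) c" "QuadRes (int p) r" "\<not> [r = 0] (mod int p)"
  shows "\<not> QuadRes (int p) (c * r)"
proof
  assume "QuadRes (int p) (c * r)"
  then obtain y where y: "[y ^ 2 = c * r] (mod int p)" unfolding QuadRes_def by blast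
  obtain z where z: "[z ^ 2 = r] (mod int p)" using assms(3) unfolding QuadRes_def by blast
  have "\<not> int p dvd z"
  proof
    assume "int p dvd z"
    hence "[z ^ 2 = 0] (mod int p)" by (simp add: cong_0_iff power2_eq_square)
    thus False using z assms(4) by (meson cong_sym cong_trans)
  qed
  hence "coprime z (int p)" using assms(1)
    by (metis coprime_commute prime_imp_coprime prime_nat_int_transfer)
  then obtain u where u: "[z * u = 1] (mod int p)" using cong_solve_coprime_int by blast
  have "[(y * u) ^ 2 = (c * r) * u ^ 2] (mod int p)"
    using y by (metis cong_scalar_right power_mult_distrib)
  also have "[(c * r) * u ^ 2 = (c * z ^ 2) * u ^ 2] (mod int p)"
    using z by (intro cong_mult) (auto intro: cong_sym)
  also have "(c * z ^ 2) * u ^ 2 = c * (z * u) ^ 2" by (simp add: power_mult_distrib)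
  also have "[c * (z * u) ^ 2 = c * 1 ^ 2] (mod int p)"
    using u by (intro cong_mult cong_pow) auto
  finally have "[(y * u) ^ 2 = c] (mod int p)" by simp
  thus False using assms(2) unfolding QuadRes_def by blast
qed

text \<open>
One of the two kinds of monochromatic chain already has non-square differences; in the other
all differences are non-zero squares, and multiplying the chain by a non-residue turns them into
non-squares. The ordering of the chain is the price for not having a symmetric relation: for
\<open>p\<close> congruent to \<open>3\<close> modulo \<open>4\<close> and \<open>x\<close>, \<open>y\<close> distinct modulo \<open>p\<close>, exactly one of \<open>x - y\<close> and
\<open>y - x\<close> is a square.
\<close>

lemma nonresidue_chain:
  assumes "prime p" "odd p" "4 ^ k \<le> p"
  shows "\<exists>xs. length xs = k \<and> sorted_wrt (\<lambda>x y. \<not> QuadRes (int p) (x - y)) xs"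
proof -
  define R where "R = (\<lambda>x y. \<not> QuadRes (int p) (x - y))"
  have "2 ^ (k + k) = (4::nat) ^ k" by (simp add: power_add flip: power_mult_distrib)
  hence "2 ^ (k + k) \<le> card {0..<int p}" using assms(3) by simp
  then obtain xs where xs: "set xs \<subseteq> {0..<int p}" "distinct xs"
    "length xs = k \<and> sorted_wrt R xs \<or> length xs = k \<and> sorted_wrt (\<lambda>x y. \<not> R x y) xs"
    using monochromatic_chain[of "{0..<int p}" k k R] by blast
  show ?thesis
  proof (cases "sorted_wrt R xs")
    case True
    with xs show ?thesis unfolding R_def by blast
  next
    case False
    with xs have len: "length xs = k" and sw: "sorted_wrt (\<lambda>x y. \<not> R x y) xs" by auto
    obtain c where c: "\<not> QuadRes (int p) c" using nonresidue_exists assms by blast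
    have *: "\<not> QuadRes (int p) (c * (xs ! i) - c * (xs ! j))" if "i < j" "j < length xs" for i j
    proof -
      have "QuadRes (int p) (xs ! i - xs ! j)"
        using sw that by (auto simp: R_def sorted_wrt_iff_nth_less)
      moreover have "\<not> [xs ! i - xs ! j = 0] (mod int p)"
      proof
        assume "[xs ! i - xs ! j = 0] (mod int p)"
        hence "[xs ! i = xs ! j] (mod int p)" by (simp add: cong_iff_dvd_diff)
        moreover have "xs ! i \<in> {0..<int p}" "xs ! j \<in> {0..<int p}"
          using xs(1) that by (meson in_mono nth_mem order.strict_trans)+
        ultimately have "xs ! i = xs ! j" by (auto simp: Cong.cong_def)
        thus False using xs(2) that by (simp add: nth_eq_iff_index_eq)
      qed
      ultimately have "\<not> QuadRes (int p) (c * (xs ! i - xs ! j))"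
        using nonresidue_times_residue assms(1) c by blast
      thus ?thesis by (simp add: right_diff_distrib)
    qed
    show ?thesis
      by (intro exI[of _ "map ((*) c) xs"]) (use * len in \<open>auto simp: sorted_wrt_iff_nth_less\<close>)
  qed
qed

section \<open>Sets with non-square differences modulo composite numbers\<close>

text \<open>
Asking for \<open>a \<noteq> b\<close> as integers, not modulo \<open>n\<close>, forces the elements of \<open>A\<close> to be distinct
modulo \<open>n\<close>, since \<open>0\<close> is a square.
\<close>

definition nonsquare_diffs :: "nat \<Rightarrow> int set \<Rightarrow> bool" where
  "nonsquare_diffs n A \<longleftrightarrow> (\<forall>a\<in>A. \<forall>b\<in>A. a \<noteq> b \<longrightarrow> \<not> QuadRes (int n) (a - b))"

definition nonsquare_diffs_of_card :: "nat \<Rightarrow> nat \<Rightarrow> bool" where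
  "nonsquare_diffs_of_card n k \<longleftrightarrow> (\<exists>A. finite A \<and> card A = k \<and> nonsquare_diffs n A)"

lemma nonsquare_diffs_of_card_1: "nonsquare_diffs_of_card n 1"
  unfolding nonsquare_diffs_of_card_def nonsquare_diffs_def by (intro exI[of _ "{0}"]) auto

text \<open>
A square modulo \<open>n\<close> is a square modulo every divisor of \<open>n\<close>, so the set for \<open>d\<close> serves for \<open>n\<close>.
Hence only the product of some distinct prime divisors of \<open>n\<close> enters, whatever their multiplicities.
\<close>

lemma nonsquare_diffs_of_card_dvd:
  "nonsquare_diffs_of_card d k \<Longrightarrow> d dvd n \<Longrightarrow> nonsquare_diffs_of_card n k"
  unfolding nonsquare_diffs_of_card_def nonsquare_diffs_def
  using QuadRes_dvd_modulus[of "int n" _ "int d"] by auto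

lemma nonsquare_diffs_of_card_family:
  assumes "finite I" and "\<And>i j. i \<in> I \<Longrightarrow> j \<in> I \<Longrightarrow> i \<noteq> j \<Longrightarrow> \<not> QuadRes (int n) (c i - c j)"
  shows "nonsquare_diffs_of_card n (card I)"
proof -
  have "inj_on c I"
    by (rule inj_onI, rule ccontr) (use assms(2) QuadRes_0 in fastforce)
  hence "card (c ` I) = card I" by (rule card_image)
  moreover have "nonsquare_diffs n (c ` I)"
    unfolding nonsquare_diffs_def using assms(2) by blast
  ultimately show ?thesis unfolding nonsquare_diffs_of_card_def using assms(1) by blast
qed

text \<open>
The Chinese remainder theorem embeds the product of the two sets; two distinct pairs differ in
some coordinate, and there the difference is a non-square.
\<close>

lemma nonsquare_diffs_of_card_mult:
  assumes "coprime m n" "nonsquare_diffs_of_card m k" "nonsquare_diffs_of_card n l"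
  shows "nonsquare_diffs_of_card (m * n) (k * l)"
proof -
  obtain A where A: "finite A" "card A = k" "nonsquare_diffs m A"
    using assms(2) unfolding nonsquare_diffs_of_card_def by blast
  obtain B where B: "finite B" "card B = l" "nonsquare_diffs n B"
    using assms(3) unfolding nonsquare_diffs_of_card_def by blast
  have "\<forall>x. \<exists>c. [c = fst x] (mod int m) \<and> [c = snd x] (mod int n)"
    using assms(1) by (auto intro!: binary_chinese_remainder_int)
  then obtain c where c: "\<And>x. [c x = fst x] (mod int m)" "\<And>x. [c x = snd x] (mod int n)"
    by metis
  have "nonsquare_diffs_of_card (m * n) (card (A \<times> B))"
  proof (rule nonsquare_diffs_of_card_family[where c = c])
    fix i j assume ij: "i \<in> A \<times> B" "j \<in> A \<times> B" "i \<noteq> j"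
    have cd: "[c i - c j = fst i - fst j] (mod int m)" "[c i - c j = snd i - snd j] (mod int n)"
      by (rule cong_diff; rule c)+
    show "\<not> QuadRes (int (m * n)) (c i - c j)"
    proof
      assume "QuadRes (int (m * n)) (c i - c j)"
      hence "QuadRes (int m) (c i - c j)" "QuadRes (int n) (c i - c j)"
        by (auto intro: QuadRes_dvd_modulus)
      hence "QuadRes (int m) (fst i - fst j)" "QuadRes (int n) (snd i - snd j)"
        using cd QuadRes_cong by blast+
      thus False using ij A(3) B(3) unfolding nonsquare_diffs_def
        by (metis mem_Times_iff prod_eqI)
    qed
  qed (use A B in auto)
  thus ?thesis using A B by (simp add: card_cartesian_product)
qed

lemma minus_one_QuadRes:
  assumes "prime p" "p mod 4 = (1::nat)"
  shows "QuadRes (int p) (-1)"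
proof (rule ccontr)
  assume nq: "\<not> QuadRes (int p) (-1)"
  have "p \<noteq> 2" using assms(2) by auto
  hence p2: "2 < p" using prime_ge_2_nat[OF assms(1)] by simp
  have "[Legendre (-1) (int p) = (-1) ^ ((p - 1) div 2)] (mod int p)"
    by (rule euler_criterion) (use assms p2 in auto)
  moreover have "even ((p - 1) div 2)" using assms(2) by presburger
  moreover have "Legendre (-1) (int p) = -1"
    using nq p2 by (auto simp: Legendre_def cong_iff_dvd_diff zdvd_not_zless)
  ultimately have "[-1 = 1] (mod int p)" by simp
  hence "int p dvd 2" by (simp add: cong_iff_dvd_diff)
  thus False using p2 zdvd_not_zless by auto
qed

text \<open>
Here \<open>-1\<close> is a square, so the order of the chain does not matter and a single prime suffices.
\<close>

lemma nonsquare_diffs_prime_1_mod_4: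
  assumes "prime p" "p mod 4 = 1" "4 ^ k \<le> p"
  shows "nonsquare_diffs_of_card p k"
proof -
  have odd: "odd p" using assms(2) by presburger
  obtain xs where xs: "length xs = k" "sorted_wrt (\<lambda>x y. \<not> QuadRes (int p) (x - y)) xs"
    using nonresidue_chain[OF assms(1) odd assms(3)] by blast
  have sym: "QuadRes (int p) (x - y)" if yx: "QuadRes (int p) (y - x)" for x y
  proof -
    obtain a where a: "[a ^ 2 = y - x] (mod int p)" using yx unfolding QuadRes_def by blast
    obtain b where b: "[b ^ 2 = -1] (mod int p)"
      using minus_one_QuadRes[OF assms(1,2)] unfolding QuadRes_def by blast
    have "[(a * b) ^ 2 = (y - x) * (-1)] (mod int p)"
      unfolding power_mult_distrib using a b by (rule cong_mult)
    thus ?thesis unfolding QuadRes_def by auto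
  qed
  have "nonsquare_diffs_of_card p (card {..<k})"
  proof (rule nonsquare_diffs_of_card_family[where c = "\<lambda>i. xs ! i"])
    fix i j assume ij: "i \<in> {..<k}" "j \<in> {..<k}" "i \<noteq> j"
    thus "\<not> QuadRes (int p) (xs ! i - xs ! j)"
      using xs sym by (cases "i < j") (auto simp: sorted_wrt_iff_nth_less, metis nat_neq_iff)
  qed auto
  thus ?thesis by simp
qed

text \<open>
Two primes are combined into a symmetric condition: the chain modulo \<open>p\<close> is matched with the
reversed chain modulo \<open>q\<close>. For \<open>i < j\<close> the difference of the \<open>i\<close>-th and the \<open>j\<close>-th element
is a non-square modulo \<open>p\<close>, and for \<open>i > j\<close> it is a non-square modulo \<open>q\<close>.
\<close>

lemma nonsquare_diffs_two_primes:
  assumes "prime p" "odd p" "4 ^ k \<le> p" "prime q" "odd q" "4 ^ k \<le> q" "p \<noteq> q"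
  shows "nonsquare_diffs_of_card (p * q) k"
proof -
  obtain xs where xs: "length xs = k" "sorted_wrt (\<lambda>x y. \<not> QuadRes (int p) (x - y)) xs"
    using nonresidue_chain assms by blast
  obtain ys where ys: "length ys = k" "sorted_wrt (\<lambda>x y. \<not> QuadRes (int q) (x - y)) ys"
    using nonresidue_chain assms by blast
  have cop: "coprime (int p) (int q)" using assms by (simp add: primes_coprime)
  have "\<forall>i. \<exists>c. [c = xs ! i] (mod int p) \<and> [c = rev ys ! i] (mod int q)"
    using cop by (auto intro!: binary_chinese_remainder_int)
  then obtain c where c: "\<And>i. [c i = xs ! i] (mod int p)" "\<And>i. [c i = rev ys ! i] (mod int q)"
    by metis
  have "nonsquare_diffs_of_card (p * q) (card {..<k})"
  proof (rule nonsquare_diffs_of_card_family[where c = c])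
    fix i j assume ij: "i \<in> {..<k}" "j \<in> {..<k}" "i \<noteq> j"
    have cd: "[c i - c j = xs ! i - xs ! j] (mod int p)"
      "[c i - c j = rev ys ! i - rev ys ! j] (mod int q)"
      by (rule cong_diff; rule c)+
    show "\<not> QuadRes (int (p * q)) (c i - c j)"
    proof
      assume "QuadRes (int (p * q)) (c i - c j)"
      hence "QuadRes (int p) (c i - c j)" "QuadRes (int q) (c i - c j)"
        by (auto intro: QuadRes_dvd_modulus)
      hence "QuadRes (int p) (xs ! i - xs ! j)" "QuadRes (int q) (rev ys ! i - rev ys ! j)"
        using cd QuadRes_cong by blast+
      moreover have "sorted_wrt (\<lambda>x y. \<not> QuadRes (int q) (y - x)) (rev ys)"
        using ys(2) by (simp add: sorted_wrt_rev)
      ultimately show False using ij xs(1) ys(1) sorted_wrt_nth_less[OF xs(2), of i j]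
          sorted_wrt_nth_less[of "\<lambda>x y. \<not> QuadRes (int q) (y - x)" "rev ys" j i]
        by (cases "i < j") auto
    qed
  qed auto
  thus ?thesis by simp
qed

definition chain_length :: "nat \<Rightarrow> nat" where
  "chain_length p = nat \<lfloor>log 4 (real p)\<rfloor>"

lemma four_power_chain_length: "p \<ge> 1 \<Longrightarrow> 4 ^ chain_length p \<le> p"
proof -
  assume p: "p \<ge> 1"
  have "0 \<le> log 4 (real p)" using p by simp
  hence "real (chain_length p) \<le> log 4 (real p)"
    unfolding chain_length_def by linarith
  hence "4 powr real (chain_length p) \<le> real p" using p by (subst (asm) le_log_iff) auto
  hence "real (4 ^ chain_length p) \<le> real p" by (simp add: powr_realpow)
  thus ?thesis by linarith
qed

text \<open>
A lower bound for the logarithm of \<open>chain_length p\<close>; the constant \<open>2\<close> absorbs both the factor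
\<open>1 / ln 4\<close> and the rounding as soon as \<open>p\<close> is at least \<open>exp (exp 3)\<close>.
\<close>

definition log_size :: "nat \<Rightarrow> real" where
  "log_size p = ln (ln (real p)) - 2"

lemma ln_chain_length:
  assumes "real p \<ge> exp (exp 3)"
  shows "chain_length p \<ge> 1" "ln (real (chain_length p)) \<ge> log_size p"
    "log_size p \<ge> 1"
proof -
  have p0: "real p > 0" using assms by (meson exp_gt_zero less_le_trans)
  have lnp: "ln (real p) \<ge> exp 3" using assms p0 by (simp add: ln_ge_iff)
  have lnp4: "ln (real p) \<ge> 4" using lnp exp_ge_add_one_self[of 3] by linarith
  have "ln (4::real) = 2 * ln 2" using ln_realpow[of 2 2] by simp
  hence ln4: "ln (4::real) \<le> 2" using ln_2_less_1 by simp
  have ln4p: "ln (4::real) > 0" by simp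
  have "exp (-2::real) \<le> 1/4"
  proof -
    have "(4::real) = 2 ^ 2" by simp
    also have "\<dots> \<le> exp 1 ^ 2" using exp_ge_add_one_self[of 1] by (intro power_mono) auto
    also have "\<dots> = exp 2" by (simp flip: exp_of_nat_mult)
    finally show ?thesis by (simp add: exp_minus field_simps)
  qed
  hence "ln (real p) * exp (-2) \<le> ln (real p) * (1/4)" using lnp4 by (intro mult_left_mono) auto
  moreover have "ln (real p) * (1/2) \<le> log 4 (real p)"
  proof -
    have "ln (real p) * (1/2) * ln 4 \<le> ln (real p) * (1/2) * 2"
      using ln4 lnp4 by (intro mult_left_mono) auto
    thus ?thesis using ln4p by (simp add: log_def field_simps)
  qed
  moreover have "log 4 (real p) - 1 \<le> real (chain_length p)"
    unfolding chain_length_def by linarith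
  ultimately have *: "ln (real p) * exp (-2) \<le> real (chain_length p)"
    using lnp4 by linarith
  moreover have pos: "0 < ln (real p) * exp (-2)" using lnp4 by simp
  ultimately show "chain_length p \<ge> 1" by (cases "chain_length p") auto
  have "log_size p = ln (ln (real p) * exp (-2))"
    unfolding log_size_def using lnp4 by (subst ln_mult) auto
  also have "\<dots> \<le> ln (real (chain_length p))"
    using * pos by (subst ln_le_cancel_iff) linarith+
  finally show "log_size p \<le> ln (real (chain_length p))" .
  have "ln (exp 3) \<le> ln (ln (real p))" using lnp lnp4 by (subst ln_le_cancel_iff) auto
  thus "log_size p \<ge> 1" by (simp add: log_size_def)
qed

lemma nonsquare_diffs_prod_1_mod_4:
  assumes "finite S" "\<And>p. p \<in> S \<Longrightarrow> prime p \<and> p mod 4 = 1 \<and> real p \<ge> exp (exp 3)"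
  shows "\<exists>k\<ge>1. nonsquare_diffs_of_card (\<Prod>S) k \<and> (\<Sum>p\<in>S. log_size p) \<le> ln (real k)"
  using assms
proof (induction S rule: finite_induct)
  case empty
  show ?case using nonsquare_diffs_of_card_1 by (intro exI[of _ 1]) auto
next
  case (insert p S)
  then obtain k where k: "k \<ge> 1" "nonsquare_diffs_of_card (\<Prod>S) k"
    "(\<Sum>p\<in>S. log_size p) \<le> ln (real k)" by auto
  have p: "prime p" "p mod 4 = 1" "real p \<ge> exp (exp 3)" using insert.prems by auto
  note l = ln_chain_length[OF p(3)]
  have "nonsquare_diffs_of_card p (chain_length p)"
    using p four_power_chain_length[of p] by (intro nonsquare_diffs_prime_1_mod_4) (auto simp: prime_ge_1_nat)
  moreover have "coprime p (\<Prod>S)"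
    using insert p by (intro prod_coprime_right) (metis insertCI primes_coprime)
  ultimately have "nonsquare_diffs_of_card (\<Prod>(insert p S)) (chain_length p * k)"
    using nonsquare_diffs_of_card_mult k insert.hyps by simp
  moreover have "(\<Sum>p\<in>insert p S. log_size p) \<le> ln (real (chain_length p * k))"
    using k l insert.hyps by (simp add: ln_mult)
  moreover have "chain_length p * k \<ge> 1" using k l by simp
  ultimately show ?case by blast
qed

text \<open>
The primes are paired off from the top. A pair contributes the \<open>log_size\<close> of its smaller member,
and this is at least the \<open>log_size\<close> of every remaining prime. Summing, the total loses against
half of the full sum only half of the largest term, which is bounded by \<open>G\<close>; keeping \<open>G\<close>
variable lets the induction pass from \<open>G\<close> to the smaller prime of the removed pair.
\<close>

lemma nonsquare_diffs_prod_odd: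
  assumes "finite S" "\<And>p. p \<in> S \<Longrightarrow> prime p \<and> odd p \<and> real p \<ge> exp (exp 3)"
    and "\<And>p. p \<in> S \<Longrightarrow> log_size p \<le> G" "G \<ge> 0"
  shows "\<exists>k\<ge>1. nonsquare_diffs_of_card (\<Prod>S) k \<and>
    (\<Sum>p\<in>S. log_size p) / 2 - G / 2 \<le> ln (real k)"
  using assms
proof (induction "card S" arbitrary: S G rule: less_induct)
  case less
  show ?case
  proof (cases "card S \<le> 1")
    case True
    hence "S = {} \<or> (\<exists>p. S = {p})" using less.prems(1) by (metis card_0_eq card_1_singletonE le_neq_implies_less less_one)
    hence "(\<Sum>p\<in>S. log_size p) \<le> G" using less.prems(3,4) by auto
    thus ?thesis using nonsquare_diffs_of_card_1 by (intro exI[of _ 1]) auto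
  next
    case False
    define q where "q = Max S"
    have "S \<noteq> {}" using False by auto
    hence q: "q \<in> S" using less.prems(1) by (simp add: q_def)
    define S1 where "S1 = S - {q}"
    have cS1: "card S1 = card S - 1" using q less.prems(1) by (simp add: S1_def)
    have S1: "S1 \<noteq> {}" using False cS1 by auto
    define p where "p = Max S1"
    have p: "p \<in> S1" unfolding p_def
      by (rule Max_in) (use S1 less.prems(1) in \<open>auto simp: S1_def\<close>)
    define S2 where "S2 = S1 - {p}"
    have fin: "finite S1" "finite S2" using less.prems(1) by (auto simp: S1_def S2_def)
    have cS2: "card S2 < card S"
      using p q less.prems(1) unfolding S1_def S2_def by (intro psubset_card_mono) auto
    have pS: "p \<in> S" "p \<noteq> q" using p by (auto simp: S1_def)
    have "p \<le> q" using pS less.prems(1) by (simp add: q_def)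
    note pp = less.prems(2)[OF pS(1)] and qq = less.prems(2)[OF q]
    have lp: "real p \<ge> exp (exp 3)" using pp by auto
    note l = ln_chain_length[OF lp]
    have le: "log_size r \<le> log_size p" if "r \<in> S2" for r
    proof -
      have r: "r \<in> S1" "r \<in> S" using that by (auto simp: S2_def S1_def)
      have "r \<le> p" using r fin by (simp add: p_def)
      have "real r \<ge> exp (exp 3)" using less.prems(2)[OF r(2)] by simp
      hence "real r > 1" by (meson exp_gt_zero less_le_trans one_less_exp_iff)
      thus ?thesis using \<open>r \<le> p\<close> by (simp add: log_size_def)
    qed
    have "\<exists>k\<ge>1. nonsquare_diffs_of_card (\<Prod>S2) k \<and>
      (\<Sum>p\<in>S2. log_size p) / 2 - log_size p / 2 \<le> ln (real k)"
    proof (rule less.hyps[OF cS2 fin(2) _ le])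
      show "prime r \<and> odd r \<and> exp (exp 3) \<le> real r" if "r \<in> S2" for r
        using that less.prems(2)[of r] by (auto simp: S2_def S1_def)
    qed (use l in auto)
    then obtain k where k: "k \<ge> 1" "nonsquare_diffs_of_card (\<Prod>S2) k"
      "(\<Sum>p\<in>S2. log_size p) / 2 - log_size p / 2 \<le> ln (real k)" by blast
    have 4: "4 ^ chain_length p \<le> p" using four_power_chain_length pp prime_ge_1_nat by blast
    have "nonsquare_diffs_of_card (p * q) (chain_length p)"
      using pp qq pS(2) 4 \<open>p \<le> q\<close> by (intro nonsquare_diffs_two_primes) auto
    moreover have "coprime (p * q) (\<Prod>S2)"
    proof -
      have "coprime p r \<and> coprime q r" if "r \<in> S2" for r
      proof -
        have "r \<in> S" "r \<noteq> p" "r \<noteq> q" using that by (auto simp: S1_def S2_def)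
        thus ?thesis using pp qq less.prems(2)[of r] by (metis primes_coprime)
      qed
      thus ?thesis by (intro prod_coprime_right) auto
    qed
    ultimately have "nonsquare_diffs_of_card (p * q * \<Prod>S2) (chain_length p * k)"
      using nonsquare_diffs_of_card_mult k by simp
    moreover have "\<Prod>S = p * q * \<Prod>S2"
      using p q fin less.prems(1) by (simp add: S2_def S1_def prod.remove[of S q] prod.remove[of S1 p] flip: S1_def)
    moreover have "(\<Sum>r\<in>S. log_size r)
        = log_size p + log_size q + (\<Sum>r\<in>S2. log_size r)"
      using p q fin less.prems(1) sum.remove[of S q log_size]
        sum.remove[of S1 p log_size] by (simp add: S2_def S1_def)
    moreover have "log_size q \<le> G" using less.prems(3) q by blast
    moreover have "ln (real (chain_length p * k)) = ln (real (chain_length p)) + ln (real k)"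
      using k l by (simp add: ln_mult)
    moreover have "chain_length p * k \<ge> 1" using k l by simp
    moreover from calculation have
      "(\<Sum>r\<in>S. log_size r) / 2 - G / 2 \<le> ln (real (chain_length p * k))"
      using k(3) l(2) by linarith
    ultimately show ?thesis by (metis (no_types, lifting))
  qed
qed

definition large_primes :: "nat \<Rightarrow> nat set" where
  "large_primes N = {p. prime p \<and> exp (exp 3) \<le> real p \<and> p \<le> N}"

definition chi4 :: "nat \<Rightarrow> real" where
  "chi4 n = (if n mod 4 = 1 then 1 else if n mod 4 = 3 then -1 else 0)"

text \<open>
The factor \<open>(3 + chi4 p) / 4\<close> is \<open>1\<close> for \<open>p\<close> congruent to \<open>1\<close> and \<open>1 / 2\<close> for \<open>p\<close> congruent to \<open>3\<close>
modulo \<open>4\<close>: the latter primes work only in pairs. Written with the character, its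
average \<open>3 / 4\<close> over the primes can be read off.
\<close>

definition prime_weight :: "nat \<Rightarrow> real" where
  "prime_weight p = (3 + chi4 p) / 4 * log_size p"

definition weight :: "nat \<Rightarrow> real" where
  "weight m = (\<Sum>p | p \<in> large_primes m \<and> p dvd m. prime_weight p)"

lemma finite_large_primes [simp]: "finite (large_primes N)"
  by (rule finite_subset[of _ "{..N}"]) (auto simp: large_primes_def)

text \<open>
The large prime divisors of \<open>m\<close> are odd. Those congruent to \<open>1\<close> modulo \<open>4\<close> contribute singly and
the others in pairs, where the term lost in the pairing is at most \<open>ln (ln m) / 2\<close>.
\<close>

lemma nonsquare_diffs_weight:
  assumes "real m \<ge> exp (exp 3)"
  shows "\<exists>k\<ge>1. nonsquare_diffs_of_card m k \<and> weight m - ln (ln (real m)) / 2 \<le> ln (real k)"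
proof -
  define S where "S = {p. p \<in> large_primes m \<and> p dvd m}"
  define S1 where "S1 = {p\<in>S. p mod 4 = 1}"
  define S3 where "S3 = {p\<in>S. p mod 4 \<noteq> 1}"
  have fin: "finite S" "finite S1" "finite S3" by (auto simp: S_def S1_def S3_def)
  have S: "prime p \<and> odd p \<and> exp (exp 3) \<le> real p \<and> p \<le> m" if "p \<in> S" for p
  proof -
    have "prime p" "exp (exp 3) \<le> real p" "p \<le> m" using that by (auto simp: S_def large_primes_def)
    moreover have "(2::real) < exp (exp 3)"
      using exp_ge_add_one_self[of 3] exp_ge_add_one_self[of "exp 3"] by linarith
    ultimately have "2 < p" by linarith
    thus ?thesis using \<open>prime p\<close> \<open>exp (exp 3) \<le> real p\<close> \<open>p \<le> m\<close> prime_odd_nat by blast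
  qed
  have "prime p \<and> p mod 4 = 1 \<and> exp (exp 3) \<le> real p" if "p \<in> S1" for p
    using that S[of p] by (simp add: S1_def)
  from nonsquare_diffs_prod_1_mod_4[OF fin(2) this]
  obtain k1 where k1: "k1 \<ge> 1" "nonsquare_diffs_of_card (\<Prod>S1) k1"
    "(\<Sum>p\<in>S1. log_size p) \<le> ln (real k1)" by blast
  have L3: "ln (ln (real m)) \<ge> 0" using ln_chain_length(3)[OF assms] by (simp add: log_size_def)
  have "\<exists>k\<ge>1. nonsquare_diffs_of_card (\<Prod>S3) k \<and>
    (\<Sum>p\<in>S3. log_size p) / 2 - ln (ln (real m)) / 2 \<le> ln (real k)"
  proof (rule nonsquare_diffs_prod_odd[OF fin(3)])
    fix p assume "p \<in> S3"
    have p: "exp (exp 3) \<le> real p" "p \<le> m" using S[of p] \<open>p \<in> S3\<close> by (auto simp: S3_def)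
    have "real p > 1" using p(1) by (rule less_le_trans[rotated]) simp
    hence "ln (ln (real p)) \<le> ln (ln (real m))" using p(2) by simp
    thus "log_size p \<le> ln (ln (real m))" by (simp add: log_size_def)
    show "prime p \<and> odd p \<and> exp (exp 3) \<le> real p" using S[of p] \<open>p \<in> S3\<close> by (simp add: S3_def)
  qed (use L3 in simp)
  then obtain k3 where k3: "k3 \<ge> 1" "nonsquare_diffs_of_card (\<Prod>S3) k3"
    "(\<Sum>p\<in>S3. log_size p) / 2 - ln (ln (real m)) / 2 \<le> ln (real k3)" by blast
  have "coprime (\<Prod>S1) (\<Prod>S3)"
  proof (intro prod_coprime_left prod_coprime_right)
    fix p q assume "p \<in> S1" "q \<in> S3"
    hence "p \<noteq> q" "prime p" "prime q" using S[of p] S[of q] by (auto simp: S1_def S3_def)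
    thus "coprime p q" by (simp add: primes_coprime)
  qed
  hence "nonsquare_diffs_of_card (\<Prod>S1 * \<Prod>S3) (k1 * k3)"
    using nonsquare_diffs_of_card_mult k1 k3 by blast
  moreover have "\<Prod>S1 * \<Prod>S3 = \<Prod>S"
    using fin by (subst prod.union_disjoint[symmetric]) (auto simp: S1_def S3_def intro!: prod.cong)
  moreover have "\<Prod>T dvd m" if "T \<subseteq> S" for T
    using finite_subset[OF that fin(1)] that
  proof (induction T rule: finite_induct)
    case (insert p T)
    have "coprime p (\<Prod>T)"
    proof (rule prod_coprime_right)
      fix q assume "q \<in> T"
      hence "prime p" "prime q" "p \<noteq> q" using insert S[of p] S[of q] by auto
      thus "coprime p q" by (simp add: primes_coprime)
    qed
    thus ?case using insert by (auto simp: S_def intro!: divides_mult)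
  qed auto
  ultimately have "nonsquare_diffs_of_card m (k1 * k3)" using nonsquare_diffs_of_card_dvd by simp
  moreover have "weight m = (\<Sum>p\<in>S1. prime_weight p) + (\<Sum>p\<in>S3. prime_weight p)"
    unfolding weight_def S_def[symmetric] using fin
    by (subst sum.union_disjoint[symmetric]) (auto simp: S1_def S3_def intro!: sum.cong)
  moreover have "(\<Sum>p\<in>S1. prime_weight p) = (\<Sum>p\<in>S1. log_size p)"
    by (intro sum.cong) (auto simp: S1_def prime_weight_def chi4_def)
  moreover have "(\<Sum>p\<in>S3. prime_weight p) = (\<Sum>p\<in>S3. log_size p) / 2"
    unfolding sum_divide_distrib
  proof (rule sum.cong)
    fix p assume "p \<in> S3"
    hence "odd p" "p mod 4 \<noteq> 1" using S[of p] by (auto simp: S3_def)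
    hence "p mod 4 = 3" by presburger
    thus "prime_weight p = log_size p / 2" by (simp add: prime_weight_def chi4_def)
  qed simp
  moreover have "ln (real (k1 * k3)) = ln (real k1) + ln (real k3)"
    using k1 k3 by (simp add: ln_mult)
  moreover have "k1 * k3 \<ge> 1" using k1 k3 by simp
  moreover from calculation have "weight m - ln (ln (real m)) / 2 \<le> ln (real (k1 * k3))"
    using k1(3) k3(3) by linarith
  ultimately show ?thesis by blast
qed

lemma nonsquare_diffs_imp_set:
  assumes "m > 1" "nonsquare_diffs_of_card m k" "k \<ge> 1"
  shows "\<exists>A \<subseteq> carrier (Zmod m). diff_set m A \<inter> squares_mod m = {\<zero>\<^bsub>Zmod m\<^esub>} \<and> card A = k"
proof -
  interpret residues "int m" "Zmod m" by unfold_locales (use assms in auto)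
  obtain A where A: "finite A" "card A = k" "nonsquare_diffs m A"
    using assms unfolding nonsquare_diffs_of_card_def by blast
  define A' where "A' = (\<lambda>a. a mod int m) ` A"
  have inj: "inj_on (\<lambda>a. a mod int m) A"
  proof (rule inj_onI, rule ccontr)
    fix a b assume ab: "a \<in> A" "b \<in> A" "a mod int m = b mod int m" "a \<noteq> b"
    hence "[a - b = 0] (mod int m)" by (simp add: cong_0_iff mod_eq_dvd_iff)
    hence "QuadRes (int m) (a - b)" using QuadRes_cong QuadRes_0 by blast
    thus False using ab A(3) unfolding nonsquare_diffs_def by blast
  qed
  have "A' \<subseteq> carrier (Zmod m)" by (use m_gt_one in \<open>auto simp: A'_def res_carrier_eq\<close>)
  moreover have "card A' = k" unfolding A'_def using inj A by (simp add: card_image)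
  moreover have "diff_set m A' \<inter> squares_mod m = {\<zero>\<^bsub>Zmod m\<^esub>}"
  proof -
    have minus: "x \<ominus>\<^bsub>Zmod m\<^esub> y = (x - y) mod int m" for x y
      by (simp add: a_minus_def res_neg_eq res_add_eq mod_simps)
    have "x = 0" if "x \<in> diff_set m A'" "x \<in> squares_mod m" for x
    proof -
      from that obtain a b where ab: "a \<in> A" "b \<in> A" "x = (a - b) mod int m"
        unfolding diff_set_def A'_def minus by (auto simp: mod_simps)
      from that obtain z where z: "x = (z * z) mod int m"
        by (auto simp: squares_mod_def res_mult_eq)
      have "[z ^ 2 = a - b] (mod int m)" using ab z by (simp add: Cong.cong_def power2_eq_square)
      hence "a = b" using ab A(3) unfolding nonsquare_diffs_def QuadRes_def by blast
      thus ?thesis using ab by simp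
    qed
    moreover have "0 \<in> squares_mod m"
      using assms(1) by (auto simp: squares_mod_def res_mult_eq res_carrier_eq intro!: exI[of _ 0])
    moreover have "0 \<in> diff_set m A'"
    proof -
      obtain a where "a \<in> A'" using A assms(3) by (metis A'_def card_eq_0_iff ex_in_conv image_is_empty not_one_le_zero)
      thus ?thesis by (auto simp: diff_set_def minus intro!: exI[of _ a])
    qed
    ultimately show ?thesis by (auto simp: res_zero_eq)
  qed
  ultimately show ?thesis by blast
qed

section \<open>Primes in the residue classes modulo 4\<close>

text \<open>
Partial summation in one-sided form. It serves twice: for the alternating series of \<open>chi4\<close>, and
to pass from weights \<open>ln p / p\<close> to weights \<open>log_size p / p\<close> with only a lower bound available
for the former.
\<close>

lemma weighted_sum_ge:
  fixes c h :: "nat \<Rightarrow> real"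
  assumes part: "\<And>k. m \<le> k \<Longrightarrow> - C \<le> (\<Sum>i=m..k. c i)"
    and anti: "\<And>k. m \<le> k \<Longrightarrow> h (Suc k) \<le> h k"
    and nonneg: "\<And>k. m \<le> k \<Longrightarrow> 0 \<le> h k" and "0 \<le> C"
  shows "- C * h m \<le> (\<Sum>k=m..n. c k * h k)"
proof (cases "m \<le> n")
  case True
  have "(\<Sum>i=m..n. c i) * h n - C * (h m - h n) \<le> (\<Sum>k=m..n. c k * h k)"
    using True
  proof (induction n rule: nat_induct_at_least)
    case (Suc n)
    have "0 \<le> ((\<Sum>i=m..n. c i) + C) * (h n - h (Suc n))"
      using part[of n] anti[of n] Suc.hyps by (intro mult_nonneg_nonneg) auto
    moreover have "(\<Sum>i=m..Suc n. c i) = (\<Sum>i=m..n. c i) + c (Suc n)"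
      "(\<Sum>k=m..Suc n. c k * h k) = (\<Sum>k=m..n. c k * h k) + c (Suc n) * h (Suc n)"
      using Suc.hyps by (auto simp: sum.nat_ivl_Suc')
    ultimately show ?case using Suc.IH by (simp add: algebra_simps)
  qed simp
  moreover have "- C * h n \<le> (\<Sum>i=m..n. c i) * h n"
    using part[OF True] nonneg[OF True] by (intro mult_right_mono) auto
  ultimately show ?thesis by (simp add: algebra_simps)
qed (use assms in simp)

lemma chi4_mult: "chi4 (a * b) = chi4 a * chi4 b"
proof -
  have "a mod 4 = 0 \<or> a mod 4 = 1 \<or> a mod 4 = 2 \<or> a mod 4 = 3"
    "b mod 4 = 0 \<or> b mod 4 = 1 \<or> b mod 4 = 2 \<or> b mod 4 = 3" by presburger+
  moreover have "(a * b) mod 4 = ((a mod 4) * (b mod 4)) mod 4" by (simp add: mod_mult_eq)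
  ultimately show ?thesis
    unfolding chi4_def by (elim disjE) simp_all
qed

lemma sum_chi4: "(\<Sum>i=1..n. chi4 i) = (if n mod 4 = 1 \<or> n mod 4 = 2 then 1 else 0)"
proof (induction n)
  case (Suc n)
  have "n mod 4 = 0 \<or> n mod 4 = 1 \<or> n mod 4 = 2 \<or> n mod 4 = 3" by presburger
  thus ?case using Suc by (auto simp: chi4_def mod_Suc)
qed simp

lemma sum_chi4_antimono:
  assumes "1 \<le> m" and "\<And>k. m \<le> k \<Longrightarrow> h (Suc k) \<le> h k" and "\<And>k. m \<le> k \<Longrightarrow> 0 \<le> h k"
  shows "\<bar>\<Sum>k=m..n. chi4 k * h k\<bar> \<le> h m"
proof -
  have "\<bar>\<Sum>i=m..k. chi4 i\<bar> \<le> 1" if "m \<le> k" for k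
  proof -
    have "{1..k} = {1..m-1} \<union> {m..k}" using assms(1) that by auto
    hence "(\<Sum>i=1..k. chi4 i) = (\<Sum>i=1..m-1. chi4 i) + (\<Sum>i=m..k. chi4 i)"
      by (simp add: sum.union_disjoint)
    thus ?thesis unfolding sum_chi4 by (auto split: if_splits)
  qed
  hence b: "-1 \<le> (\<Sum>i=m..k. chi4 i)" "-1 \<le> (\<Sum>i=m..k. - chi4 i)" if "m \<le> k" for k
    using that by (auto simp: abs_le_iff sum_negf)
  have "-1 * h m \<le> (\<Sum>k=m..n. chi4 k * h k)"
    by (rule weighted_sum_ge) (use assms b in auto)
  moreover have "-1 * h m \<le> (\<Sum>k=m..n. - chi4 k * h k)"
    by (rule weighted_sum_ge) (use assms b in auto)
  ultimately show ?thesis by (simp add: sum_negf)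
qed

text \<open>
Both sides sum over the pairs \<open>(d, k)\<close> with \<open>d * k \<le> N\<close>.
\<close>

lemma sum_divisors_swap:
  fixes f :: "nat \<Rightarrow> nat \<Rightarrow> 'a :: comm_monoid_add"
  shows "(\<Sum>n=1..N. \<Sum>d | d dvd n. f d (n div d)) = (\<Sum>d=1..N. \<Sum>k=1..N div d. f d k)"
proof -
  have aux: "b \<le> N" if "b * k \<le> N" "0 < k" for b k :: nat
    using that by (metis le_trans mult.right_neutral mult_le_mono2 Suc_leI One_nat_def)
  have "(\<Sum>n=1..N. \<Sum>d | d dvd n. f d (n div d))
      = (\<Sum>(n, d)\<in>(SIGMA n:{1..N}. {d. d dvd n}). f d (n div d))"
    by (rule sum.Sigma) auto
  also have "\<dots> = (\<Sum>(d, k)\<in>(SIGMA d:{1..N}. {1..N div d}). f d k)"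
    by (rule sum.reindex_bij_witness[of _ "\<lambda>(d, k). (d * k, d)" "\<lambda>(n, d). (d, n div d)"])
      (auto elim!: dvdE simp: less_eq_div_iff_mult_less_eq mult.commute Suc_le_eq
        intro: aux)
  also have "\<dots> = (\<Sum>d=1..N. \<Sum>k=1..N div d. f d k)"
    by (rule sum.Sigma[symmetric]) auto
  finally show ?thesis .
qed

lemma sum_mangoldt_div: "(\<Sum>d=1..N. mangoldt d * real (N div d)) = ln (fact N)"
proof -
  have "ln (fact N) = (\<Sum>n=1..N. ln (real n))"
    by (induction N) (simp_all add: ln_mult)
  also have "\<dots> = (\<Sum>n=1..N. \<Sum>d | d dvd n. mangoldt d)"
    by (intro sum.cong) (auto simp: mangoldt_sum)
  also have "\<dots> = (\<Sum>d=1..N. \<Sum>k=1..N div d. mangoldt d)"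
    by (rule sum_divisors_swap)
  finally show ?thesis by (simp add: mult.commute)
qed

lemma ln_Suc_diff_le: "real n * (ln (real (Suc n)) - ln (real n)) \<le> 1"
proof (cases "n = 0")
  case False
  have "real (Suc n) / real n = 1 + 1 / real n" using False by (simp add: field_simps)
  hence "ln (real (Suc n)) - ln (real n) = ln (1 + 1 / real n)"
    using False ln_div[of "real (Suc n)" "real n"] by (simp del: of_nat_Suc)
  also have "\<dots> \<le> 1 / real n" by (rule ln_add_one_self_le_self) simp
  finally show ?thesis using False by (simp add: field_simps)
qed simp

lemma ln_fact_ge: "real N * ln (real N) - real N \<le> ln (fact N)"
proof (induction N)
  case (Suc N)
  show ?case
  proof (cases "N = 0")
    case False
    have "ln (fact (Suc N) :: real) = ln (real (Suc N)) + ln (fact N)"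
      by (simp add: ln_mult)
    thus ?thesis using Suc ln_Suc_diff_le[of N] by (simp add: algebra_simps)
  qed simp
qed simp

definition chebyshev_psi :: "nat \<Rightarrow> real" where
  "chebyshev_psi N = (\<Sum>d=1..N. mangoldt d)"

lemma chebyshev_psi_mono: "m \<le> n \<Longrightarrow> chebyshev_psi m \<le> chebyshev_psi n"
  unfolding chebyshev_psi_def by (intro sum_mono2) (auto simp: mangoldt_nonneg)

text \<open>
The logarithm of the central binomial coefficient is the sum of
\<open>mangoldt d * (2 * n div d - 2 * (n div d))\<close>. Every term is non-negative, and for \<open>d\<close> between
\<open>n + 1\<close> and \<open>2 * n\<close> the second factor is \<open>1\<close>.
\<close>

lemma chebyshev_psi_double: "chebyshev_psi (2 * n) \<le> chebyshev_psi n + 2 * real n"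
proof -
  have eq: "(\<Sum>d=1..n. mangoldt d * real (n div d)) = (\<Sum>d=1..2*n. mangoldt d * real (n div d))"
    by (intro sum.mono_neutral_left) auto
  have "chebyshev_psi (2 * n) - chebyshev_psi n = (\<Sum>d\<in>{1..2*n} - {1..n}. mangoldt d)"
    unfolding chebyshev_psi_def by (subst sum_diff) auto
  also have "\<dots> = (\<Sum>d=1..2*n. if n < d then mangoldt d else 0)"
    by (intro sum.mono_neutral_cong_left) auto
  also have "\<dots> \<le> (\<Sum>d=1..2*n. mangoldt d * (real (2 * n div d) - 2 * real (n div d)))"
  proof (rule sum_mono)
    fix d assume d: "d \<in> {1..2*n}"
    have "2 * (n div d) \<le> 2 * n div d"
      using d by (simp add: less_eq_div_iff_mult_less_eq)
    hence "real (2 * (n div d)) \<le> real (2 * n div d)" by (rule of_nat_mono)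
    moreover have "real (2 * n div d) \<ge> 1 \<and> n div d = 0" if "n < d"
      using d that by (simp add: Suc_le_eq div_greater_zero_iff)
    ultimately show "(if n < d then mangoldt d else 0) \<le>
        mangoldt d * (real (2 * n div d) - 2 * real (n div d))"
      using mangoldt_nonneg[of d] mult_left_mono[of 1 "real (2 * n div d)" "mangoldt d"] by auto
  qed
  also have "\<dots> = ln (fact (2 * n)) - 2 * ln (fact n)"
    unfolding sum_mangoldt_div[symmetric] eq
    by (simp add: algebra_simps sum_subtractf sum_distrib_left)
  also have "\<dots> = ln (real (2 * n choose n))"
  proof -
    have "fact n * fact n * (2 * n choose n) = (fact (2 * n) :: nat)"
      using binomial_fact_lemma[of n "2 * n"] by simp
    hence e: "(fact n * fact n * real (2 * n choose n) :: real) = fact (2 * n)"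
      by (metis of_nat_fact of_nat_mult)
    moreover have "0 < 2 * n choose n" by simp
    ultimately have "ln (fact (2 * n) :: real) = ln (fact n) + ln (fact n) + ln (real (2 * n choose n))"
      by (simp add: ln_mult flip: e)
    thus ?thesis by simp
  qed
  also have "\<dots> \<le> ln (2 ^ (2 * n))"
  proof -
    have "real (2 * n choose n) \<le> real (2 ^ (2 * n))"
      using binomial_le_pow2[of "2 * n" n] by (simp only: of_nat_le_iff)
    thus ?thesis by (subst ln_le_cancel_iff) auto
  qed
  also have "\<dots> = 2 * real n * ln 2" by (simp add: ln_realpow)
  also have "\<dots> \<le> 2 * real n * 1" using ln_2_less_1 by (intro mult_left_mono) auto
  finally show ?thesis by simp
qed

lemma chebyshev_psi_le: "chebyshev_psi N \<le> 4 * real N"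
proof (cases "N = 0")
  case False
  have pow: "chebyshev_psi (2 ^ k) \<le> 2 ^ (k + 1)" for k
  proof (induction k)
    case (Suc k)
    thus ?case using chebyshev_psi_double[of "2 ^ k"] by simp
  qed (simp add: chebyshev_psi_def)
  obtain k where k: "2 ^ k \<le> N" "N < 2 ^ (k + 1)"
    using ex_power_ivl1[of 2 N] False by auto
  have "chebyshev_psi N \<le> chebyshev_psi (2 ^ (k + 1))"
    using k by (intro chebyshev_psi_mono) auto
  also have "\<dots> \<le> 2 ^ (k + 1 + 1)" by (rule pow)
  also have "\<dots> = 4 * real (2 ^ k)" by simp
  also have "\<dots> \<le> 4 * real N" using k(1) by (intro mult_left_mono of_nat_mono) auto
  finally show ?thesis .
qed (simp add: chebyshev_psi_def)

lemma sum_mangoldt_over_ge: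
  assumes "N \<ge> 1"
  shows "ln (real N) - 1 \<le> (\<Sum>d=1..N. mangoldt d / real d)"
proof -
  have "real N * ln (real N) - real N \<le> (\<Sum>d=1..N. mangoldt d * real (N div d))"
    unfolding sum_mangoldt_div by (rule ln_fact_ge)
  also have "\<dots> \<le> (\<Sum>d=1..N. mangoldt d * (real N / real d))"
    by (intro sum_mono mult_left_mono mangoldt_nonneg of_nat_div_le_of_nat)
  also have "\<dots> = real N * (\<Sum>d=1..N. mangoldt d / real d)"
    by (simp add: sum_distrib_left field_simps)
  finally have "real N * (ln (real N) - 1) \<le> real N * (\<Sum>d=1..N. mangoldt d / real d)"
    by (simp add: algebra_simps)
  thus ?thesis using assms by simp
qed

text \<open>
The partial sums of the Dirichlet series of \<open>chi4\<close> at \<open>1\<close>. Using the partial sum at the full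
length \<open>N\<close> in place of the limit keeps the argument below within finite sums.
\<close>

definition L_chi4 :: "nat \<Rightarrow> real" where
  "L_chi4 N = (\<Sum>k=1..N. chi4 k * (1 / real k))"

lemma L_chi4_ge:
  assumes "N \<ge> 1"
  shows "L_chi4 N \<ge> 2 / 3"
proof (cases "N \<ge> 3")
  case True
  have "{1..N} = {1, 2} \<union> {3..N}" using True by auto
  hence "L_chi4 N = 1 + (\<Sum>k=3..N. chi4 k * (1 / real k))"
    unfolding L_chi4_def by (simp add: sum.union_disjoint chi4_def)
  moreover have "\<bar>\<Sum>k=3..N. chi4 k * (1 / real k)\<bar> \<le> 1 / real 3"
    by (rule sum_chi4_antimono) (auto simp: field_simps)
  ultimately show ?thesis by simp
next
  case False
  hence "N = 1 \<or> N = 2" using assms by auto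
  moreover have "{1..2} = {1, 2::nat}" by auto
  ultimately show ?thesis by (auto simp: L_chi4_def chi4_def)
qed

lemma L_chi4_diff:
  assumes "m \<le> n"
  shows "\<bar>L_chi4 m - L_chi4 n\<bar> \<le> 1 / real (m + 1)"
proof -
  have "{1..n} = {1..m} \<union> {m+1..n}" using assms by auto
  hence "L_chi4 n = L_chi4 m + (\<Sum>k=m+1..n. chi4 k * (1 / real k))"
    unfolding L_chi4_def by (simp add: sum.union_disjoint)
  moreover have "\<bar>\<Sum>k=m+1..n. chi4 k * (1 / real k)\<bar> \<le> 1 / real (m + 1)"
    by (rule sum_chi4_antimono) (auto simp: field_simps)
  ultimately show ?thesis by simp
qed

lemma sum_chi4_ln_bounded: "\<bar>\<Sum>n=1..N. chi4 n * (ln (real n) / real n)\<bar> \<le> 1"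
proof -
  have ln1: "ln (real k) \<ge> 1" if "3 \<le> k" for k
  proof -
    have "exp 1 \<le> real k" using exp_le that by simp
    thus ?thesis using that by (simp add: ln_ge_iff)
  qed
  have "(\<Sum>n=1..N. chi4 n * (ln (real n) / real n)) = (\<Sum>n=3..N. chi4 n * (ln (real n) / real n))"
  proof (rule sum.mono_neutral_right)
    show "\<forall>i\<in>{1..N} - {3..N}. chi4 i * (ln (real i) / real i) = 0"
    proof
      fix i assume "i \<in> {1..N} - {3..N}"
      hence "i = 1 \<or> i = 2" by auto
      thus "chi4 i * (ln (real i) / real i) = 0" by (auto simp: chi4_def)
    qed
  qed auto
  also have "\<bar>\<dots>\<bar> \<le> ln (real 3) / real 3"
  proof (rule sum_chi4_antimono)
    fix k :: nat assume k: "3 \<le> k"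
    have "real k * ln (real (Suc k)) \<le> real (Suc k) * ln (real k)"
      using ln1[OF k] ln_Suc_diff_le[of k] by (simp add: algebra_simps)
    thus "ln (real (Suc k)) / real (Suc k) \<le> ln (real k) / real k"
      using k by (simp add: field_simps)
  qed (use ln1 in \<open>force+\<close>)
  also have "\<dots> \<le> 1" using ln_le_minus_one[of 3] by simp
  finally show ?thesis .
qed

text \<open>
The bounded sum of \<open>chi4 n * ln n / n\<close> is, by \<open>ln n = (\<Sum>d | d dvd n. mangoldt d)\<close> and
multiplicativity, the sum of \<open>chi4 d * mangoldt d / d * L_chi4 (N div d)\<close>. Replacing
\<open>L_chi4 (N div d)\<close> by \<open>L_chi4 N\<close> costs at most \<open>chebyshev_psi N / N \<le> 4\<close>, and \<open>L_chi4 N\<close> stays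
away from \<open>0\<close>. So the primes congruent to \<open>3\<close> modulo \<open>4\<close> cannot dominate those congruent to \<open>1\<close>.
\<close>

lemma sum_chi4_mangoldt_ge: "- (15 / 2) \<le> (\<Sum>d=1..N. chi4 d * mangoldt d / real d)"
proof (cases "N = 0")
  case False
  define T where "T = (\<Sum>d=1..N. chi4 d * mangoldt d / real d)"
  have "(\<Sum>n=1..N. chi4 n * (ln (real n) / real n))
      = (\<Sum>n=1..N. \<Sum>d | d dvd n. chi4 d * mangoldt d / real d * (chi4 (n div d) * (1 / real (n div d))))"
  proof (rule sum.cong)
    fix n assume n: "n \<in> {1..N}"
    have "chi4 n * (ln (real n) / real n) = (\<Sum>d | d dvd n. chi4 n / real n * mangoldt d)"
      unfolding sum_distrib_left[symmetric] using n mangoldt_sum[of n, where ?'a = real] by simp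
    also have "\<dots> = (\<Sum>d | d dvd n. chi4 d * mangoldt d / real d * (chi4 (n div d) * (1 / real (n div d))))"
      by (rule sum.cong) (use n in \<open>auto elim!: dvdE simp: chi4_mult\<close>)
    finally show "chi4 n * (ln (real n) / real n) = \<dots>" .
  qed simp
  also have "\<dots> = (\<Sum>d=1..N. chi4 d * mangoldt d / real d * L_chi4 (N div d))"
    unfolding sum_divisors_swap[where f = "\<lambda>d k. chi4 d * mangoldt d / real d * (chi4 k * (1 / real k))"]
    by (simp add: L_chi4_def sum_distrib_left)
  also have "\<dots> = T * L_chi4 N
      + (\<Sum>d=1..N. chi4 d * mangoldt d / real d * (L_chi4 (N div d) - L_chi4 N))"
    unfolding T_def sum_distrib_right sum.distrib[symmetric] by (simp add: right_diff_distrib)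
  finally have eq: "(\<Sum>n=1..N. chi4 n * (ln (real n) / real n)) = \<dots>" .
  have "\<bar>\<Sum>d=1..N. chi4 d * mangoldt d / real d * (L_chi4 (N div d) - L_chi4 N)\<bar>
      \<le> (\<Sum>d=1..N. mangoldt d / real N)"
  proof (rule order.trans[OF sum_abs sum_mono])
    fix d assume d: "d \<in> {1..N}"
    have "N < d * (N div d + 1)" using d dividend_less_times_div[of d N] by (simp add: algebra_simps)
    hence "real N < real d * real (N div d + 1)" by (metis of_nat_less_iff of_nat_mult)
    hence "1 / real (N div d + 1) \<le> real d / real N" using d False by (simp add: field_simps)
    hence "\<bar>L_chi4 (N div d) - L_chi4 N\<bar> \<le> real d / real N"
      using L_chi4_diff[of "N div d" N] by simp
    hence "\<bar>chi4 d * mangoldt d / real d\<bar> * \<bar>L_chi4 (N div d) - L_chi4 N\<bar>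
        \<le> mangoldt d / real d * (real d / real N)"
      using mangoldt_nonneg[of d]
      by (intro mult_mono) (auto simp: abs_mult chi4_def)
    thus "\<bar>chi4 d * mangoldt d / real d * (L_chi4 (N div d) - L_chi4 N)\<bar> \<le> mangoldt d / real N"
      using d by (simp add: abs_mult)
  qed
  also have "\<dots> = chebyshev_psi N / real N" by (simp add: chebyshev_psi_def sum_divide_distrib)
  also have "\<dots> \<le> 4" using chebyshev_psi_le[of N] False by (simp add: field_simps)
  finally have "- 5 \<le> T * L_chi4 N" using eq sum_chi4_ln_bounded[of N] by linarith
  moreover have "T * L_chi4 N \<le> T * (2 / 3)" if "T \<le> 0"
    using that L_chi4_ge[of N] False by (intro mult_left_mono_neg) auto
  ultimately show ?thesis unfolding T_def[symmetric] by linarith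
qed simp

text \<open>
Proper prime powers are negligible: for each prime \<open>p\<close> they form a geometric series with sum at
most \<open>2 * ln p / p ^ 2\<close>.
\<close>

lemma prime_powers_sum_bounded:
  "\<exists>C. \<forall>N. (\<Sum>n | n \<in> {1..N} \<and> \<not> prime n. mangoldt n / real n) \<le> C"
proof -
  define u where "u = (\<lambda>n. 2 * (ln (real n) / real n ^ 2))"
  have "summable (\<lambda>n. real n powr (-3/2))" by (subst summable_real_powr_iff) simp
  hence "summable (\<lambda>n. norm (real n powr (-3/2)))" by simp
  moreover have "u \<in> O(\<lambda>n. real n powr (-3/2))" unfolding u_def by real_asymp
  ultimately have summ: "summable u" by (rule summable_comparison_test_bigo)
  have u0: "u n \<ge> 0" for n by (cases n) (auto simp: u_def)
  show ?thesis
  proof (intro exI[of _ "suminf u"] allI)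
    fix N :: nat
    define D where "D = {p \<in> {2..N}. prime p} \<times> {..N}"
    \<comment> \<open>\<open>j + 2\<close> ranges over the exponents of proper prime powers.\<close>
    define g where "g = (\<lambda>(p::nat, j::nat). p ^ (j + 2))"
    have finD: "finite D" by (simp add: D_def)
    define Z where "Z = {n \<in> {1..N}. \<not> prime n \<and> primepow n}"
    have "(\<Sum>n | n \<in> {1..N} \<and> \<not> prime n. mangoldt n / real n) = (\<Sum>n\<in>Z. mangoldt n / real n)"
      by (rule sum.mono_neutral_right) (auto simp: Z_def mangoldt_def)
    also have "\<dots> \<le> (\<Sum>n\<in>g ` D. mangoldt n / real n)"
    proof (rule sum_mono2)
      show "Z \<subseteq> g ` D"
      proof
        fix n assume n: "n \<in> Z"
        then obtain p k where pk: "prime p" "k > 0" "n = p ^ k"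
          unfolding Z_def by (auto simp: primepow_def)
        have "k \<noteq> 1" using n pk by (auto simp: Z_def)
        with pk(2) have k: "k = (k - 2) + 2" by simp
        have "p \<ge> 2" using pk prime_ge_2_nat by blast
        have "p \<le> n" using pk \<open>p \<ge> 2\<close> by (simp add: self_le_power)
        moreover have "k \<le> n" using pk \<open>p \<ge> 2\<close> by (metis less_exp less_imp_le order.trans power_mono zero_le)
        moreover have "n \<le> N" using n by (simp add: Z_def)
        ultimately have "p \<le> N" "k - 2 \<le> N" by linarith+
        hence "(p, k - 2) \<in> D" using pk \<open>p \<ge> 2\<close> by (simp add: D_def)
        moreover have "g (p, k - 2) = n" unfolding g_def pk(3) prod.case k[symmetric] by (rule refl)
        ultimately show "n \<in> g ` D" by force
      qed
    qed (use finD in \<open>auto simp: mangoldt_nonneg\<close>)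
    also have "\<dots> \<le> (\<Sum>x\<in>D. mangoldt (g x) / real (g x))"
      using sum_image_le[OF finD, of "\<lambda>n. mangoldt n / real n" g] by (simp add: mangoldt_nonneg o_def)
    also have "\<dots> = (\<Sum>(p, j)\<in>D. ln (real p) / real p ^ 2 * (1 / real p) ^ j)"
    proof (rule sum.cong)
      fix x assume "x \<in> D"
      then obtain p j where x: "x = (p, j)" "prime p" by (auto simp: D_def)
      have "(mangoldt (p ^ (j + 2)) :: real) = ln (real p)" using x by (subst mangoldt_primepow) auto
      moreover have "ln (real p) / real (p ^ (j + 2)) = ln (real p) / real p ^ 2 * (1 / real p) ^ j"
        by (simp add: power_add power_one_over divide_inverse power_inverse power2_eq_square)
      ultimately show "mangoldt (g x) / real (g x)
          = (case x of (p, j) \<Rightarrow> ln (real p) / real p ^ 2 * (1 / real p) ^ j)"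
        by (simp only: x(1) g_def prod.case)
    qed simp
    also have "\<dots> = (\<Sum>p | p \<in> {2..N} \<and> prime p. \<Sum>j\<le>N. ln (real p) / real p ^ 2 * (1 / real p) ^ j)"
      unfolding D_def by (rule sum.cartesian_product[symmetric])
    also have "\<dots> \<le> (\<Sum>p | p \<in> {2..N} \<and> prime p. u p)"
    proof (rule sum_mono)
      fix p assume "p \<in> {p. p \<in> {2..N} \<and> prime p}"
      hence p: "p \<ge> 2" by simp
      have "(\<Sum>j\<le>N. (1 / real p) ^ j) \<le> (\<Sum>j\<le>N. (1 / 2) ^ j)"
        using p by (intro sum_mono power_mono) (auto simp: field_simps)
      also have "\<dots> \<le> (\<Sum>j. (1 / 2 :: real) ^ j)"
        by (intro sum_le_suminf) (auto intro: summable_geometric)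
      also have "\<dots> = 2" by (subst suminf_geometric) auto
      finally have "ln (real p) / real p ^ 2 * (\<Sum>j\<le>N. (1 / real p) ^ j) \<le> ln (real p) / real p ^ 2 * 2"
        using p by (intro mult_left_mono) auto
      thus "(\<Sum>j\<le>N. ln (real p) / real p ^ 2 * (1 / real p) ^ j) \<le> u p"
        by (simp only: u_def sum_distrib_left mult.commute[of 2])
    qed
    also have "\<dots> \<le> suminf u" by (rule sum_le_suminf[OF summ]) (use u0 in auto)
    finally show "(\<Sum>n | n \<in> {1..N} \<and> \<not> prime n. mangoldt n / real n) \<le> suminf u" .
  qed
qed

text \<open>
Mertens' estimate weighted by \<open>(3 + chi4 p) / 4\<close>. The lower bound for the sum of
\<open>mangoldt n / n\<close> enters with factor \<open>3 / 4\<close>, the bound for its twist by \<open>chi4\<close> with \<open>1 / 4\<close>.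
\<close>

lemma mertens_weighted:
  "\<exists>C. \<forall>N\<ge>1. 3 / 4 * ln (real N) - C \<le>
    (\<Sum>n=1..N. if prime n then (3 + chi4 n) / 4 * ln (real n) / real n else 0)"
proof -
  obtain C where C: "\<And>N. (\<Sum>n | n \<in> {1..N} \<and> \<not> prime n. mangoldt n / real n) \<le> C"
    using prime_powers_sum_bounded by blast
  show ?thesis
  proof (intro exI[of _ "C + 3"] allI impI)
    fix N :: nat assume N: "N \<ge> 1"
    define P where "P = (\<Sum>n=1..N. if prime n then (3 + chi4 n) / 4 * ln (real n) / real n else 0)"
    have "3 / 4 * (\<Sum>n=1..N. mangoldt n / real n) + 1 / 4 * (\<Sum>n=1..N. chi4 n * mangoldt n / real n)
        = (\<Sum>n=1..N. (3 + chi4 n) / 4 * mangoldt n / real n)"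
      by (simp add: sum_distrib_left field_simps flip: sum.distrib)
    also have "\<dots> \<le> (\<Sum>n=1..N. (if prime n then (3 + chi4 n) / 4 * ln (real n) / real n else 0)
        + (if prime n then 0 else mangoldt n / real n))"
    proof (rule sum_mono)
      fix n assume "n \<in> {1..N}"
      have "(3 + chi4 n) / 4 * mangoldt n / real n \<le> 1 * mangoldt n / real n"
        by (intro divide_right_mono mult_right_mono) (auto simp: chi4_def mangoldt_nonneg)
      thus "(3 + chi4 n) / 4 * mangoldt n / real n \<le>
        (if prime n then (3 + chi4 n) / 4 * ln (real n) / real n else 0)
        + (if prime n then 0 else mangoldt n / real n)" by simp
    qed
    also have "\<dots> = P + (\<Sum>n | n \<in> {1..N} \<and> \<not> prime n. mangoldt n / real n)"
      by (simp add: sum.distrib P_def sum.If_cases Int_def conj_commute)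
    finally show "3 / 4 * ln (real N) - (C + 3) \<le> P"
      using C[of N] sum_mangoldt_over_ge[OF N] sum_chi4_mangoldt_ge[of N] by argo
  qed
qed

lemma harmonic_le: "N \<ge> 1 \<Longrightarrow> (\<Sum>i=1..N. 1 / real i) \<le> 1 + ln (real N)"
proof (induction N rule: nat_induct_at_least)
  case (Suc N)
  have "ln (real N) - ln (real (Suc N)) = ln (real N / real (Suc N))"
    using Suc.hyps by (subst ln_div) auto
  also have "\<dots> \<le> real N / real (Suc N) - 1" using Suc.hyps by (intro ln_le_minus_one) auto
  also have "\<dots> = - (1 / real (Suc N))" by (simp add: field_simps)
  finally show ?case using Suc.IH by simp
qed simp

text \<open>
With \<open>u = ln (ln s)\<close> the quotient is \<open>(u - 2) * exp (- u)\<close>, which decreases for \<open>u \<ge> 3\<close>. This is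
where the threshold \<open>exp (exp 3)\<close> comes from.
\<close>

lemma log_size_over_ln_antimono:
  fixes s t :: real
  assumes "exp (exp 3) \<le> s" "s \<le> t"
  shows "(ln (ln t) - 2) / ln t \<le> (ln (ln s) - 2) / ln s"
proof -
  define u where "u = ln (ln s)"
  define v where "v = ln (ln t)"
  have s: "s > 0" "t > 0" using assms by (meson exp_gt_zero less_le_trans)+
  have lns: "exp 3 \<le> ln s" using assms s by (simp add: ln_ge_iff)
  hence lns0: "ln s > 0" by (meson exp_gt_zero less_le_trans)
  have lnt: "ln s \<le> ln t" using assms s by simp
  have u3: "u \<ge> 3" using lns lns0 by (simp add: u_def ln_ge_iff)
  have uv: "u \<le> v" using lnt lns0 by (simp add: u_def v_def)
  have eu: "ln s = exp u" "ln t = exp v" using lns0 lnt by (auto simp: u_def v_def)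
  have "v - 2 \<le> (u - 2) * (1 + (v - u))"
    using mult_right_mono[of 1 "u - 2" "v - u"] u3 uv by (simp add: algebra_simps)
  also have "\<dots> \<le> (u - 2) * exp (v - u)"
    using u3 by (intro mult_left_mono exp_ge_add_one_self) auto
  finally have "v - 2 \<le> (u - 2) / exp u * exp v" by (simp add: exp_diff)
  hence "(v - 2) / exp v \<le> (u - 2) / exp u" by (simp add: divide_le_eq)
  thus ?thesis by (simp add: eu(1) eu(2))
qed

text \<open>
\<open>log_size ^ 2 / 2\<close> is an antiderivative of the decreasing function \<open>t \<mapsto> log_size t / (ln t * t)\<close>.
\<close>

lemma log_size_square_increment:
  assumes "exp (exp 3) \<le> real k"
  shows "(log_size (Suc k))\<^sup>2 / 2 - (log_size k)\<^sup>2 / 2 \<le> log_size k / ln (real k) / real k"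
proof -
  have k1: "real k > 1" using assms by (rule less_le_trans[rotated]) simp
  have "\<exists>z. real k < z \<and> z < real (Suc k) \<and>
    (ln (ln (real (Suc k))) - 2)\<^sup>2 / 2 - (ln (ln (real k)) - 2)\<^sup>2 / 2
      = (real (Suc k) - real k) * ((ln (ln z) - 2) / ln z / z)"
  proof (rule MVT2)
    fix x assume "real k \<le> x"
    hence "x > 1" using k1 by simp
    thus "((\<lambda>x. (ln (ln x) - 2)\<^sup>2 / 2) has_real_derivative (ln (ln x) - 2) / ln x / x) (at x)"
      by (auto intro!: derivative_eq_intros simp: field_simps)
  qed simp
  then obtain z where z: "real k < z"
    "(log_size (Suc k))\<^sup>2 / 2 - (log_size k)\<^sup>2 / 2 = (ln (ln z) - 2) / ln z / z"
    by (auto simp: log_size_def)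
  have pos: "0 \<le> (ln (ln (real k)) - 2) / ln (real k)"
    using ln_chain_length(3)[OF assms] k1 by (simp add: log_size_def)
  have "(ln (ln z) - 2) / ln z / z \<le> (ln (ln (real k)) - 2) / ln (real k) / z"
    using z k1 assms by (intro divide_right_mono log_size_over_ln_antimono) auto
  also have "\<dots> \<le> (ln (ln (real k)) - 2) / ln (real k) / real k"
    using z k1 pos by (intro divide_left_mono) auto
  finally show ?thesis unfolding z(2) by (simp add: log_size_def)
qed

definition mean_weight :: "nat \<Rightarrow> real" where
  "mean_weight N = (\<Sum>p\<in>large_primes N. prime_weight p / real p)"

text \<open>
Partial summation compares the primes, weighted with \<open>(3 + chi4 p) / 4 * ln p / p\<close>, with all
integers, weighted with \<open>3 / 4 * 1 / k\<close>; the sum of \<open>log_size k / (ln k * k)\<close> over the integers is at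
least \<open>log_size N ^ 2 / 2\<close> up to a constant. This produces \<open>3 / 8 = 3 / 4 * 1 / 2\<close>.
\<close>

lemma mean_weight_ge:
  "\<exists>C\<ge>0. \<forall>N. exp (exp 3) \<le> real N \<longrightarrow> 3 / 8 * (log_size N)\<^sup>2 - C \<le> mean_weight N"
proof -
  obtain C where C: "\<And>N. N \<ge> 1 \<Longrightarrow> 3 / 4 * ln (real N) - C \<le>
      (\<Sum>n=1..N. if prime n then (3 + chi4 n) / 4 * ln (real n) / real n else 0)"
    using mertens_weighted by blast
  define m where "m = nat \<lceil>exp (exp 3) :: real\<rceil>"
  have m_iff: "m \<le> n \<longleftrightarrow> exp (exp 3) \<le> real n" for n
    unfolding m_def by (simp add: nat_le_iff ceiling_le_iff)
  have m1: "m \<ge> 1"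
    by (metis One_nat_def Suc_leI m_def ceiling_le_zero exp_gt_zero not_le zero_less_nat_eq)
  define c where "c = (\<lambda>n. (if prime n then (3 + chi4 n) / 4 * ln (real n) / real n else 0)
    - 3 / 4 * (1 / real n))"
  define h where "h = (\<lambda>n. log_size n / ln (real n))"
  \<comment> \<open>The absolute values only serve to make \<open>K\<close> non-negative; the last term
    accounts for starting the sums at \<open>m\<close>.\<close>
  define K where "K = \<bar>C\<bar> + 3 / 4 + \<bar>\<Sum>i=1..m-1. c i\<bar>"
  have ln_pos: "ln (real n) > 0" if "m \<le> n" for n
  proof -
    have "1 < real n" using that unfolding m_iff by (rule less_le_trans[rotated]) simp
    thus ?thesis by simp
  qed
  have h0: "0 \<le> h k" if "m \<le> k" for k
    using ln_chain_length(3)[of k] that ln_pos[OF that] by (auto simp: h_def m_iff)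
  have main: "- K * h m \<le> (\<Sum>k=m..N. c k * h k)" for N
  proof (rule weighted_sum_ge)
    fix k assume k: "m \<le> k"
    have "{1..k} = {1..m-1} \<union> {m..k}" using m1 k by auto
    hence "(\<Sum>i=1..k. c i) = (\<Sum>i=1..m-1. c i) + (\<Sum>i=m..k. c i)"
      by (simp add: sum.union_disjoint)
    moreover have "(\<Sum>i=1..k. c i) \<ge> - \<bar>C\<bar> - 3 / 4"
    proof -
      have "(\<Sum>i=1..k. c i) = (\<Sum>n=1..k. if prime n then (3 + chi4 n) / 4 * ln (real n) / real n else 0)
        - 3 / 4 * (\<Sum>i=1..k. 1 / real i)"
        unfolding c_def by (simp add: sum_subtractf sum_distrib_left)
      thus ?thesis using C[of k] harmonic_le[of k] m1 k by linarith
    qed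
    ultimately show "- K \<le> (\<Sum>i=m..k. c i)" unfolding K_def by linarith
    show "h (Suc k) \<le> h k" unfolding h_def log_size_def
      using k by (intro log_size_over_ln_antimono) (auto simp: m_iff)
  qed (use h0 in \<open>auto simp: K_def\<close>)
  show ?thesis
  proof (intro exI[of _ "\<bar>K * h m\<bar> + 3 / 8 * (log_size m)\<^sup>2"] conjI allI impI)
    fix N assume "exp (exp 3) \<le> real N"
    hence N: "m \<le> N" by (simp add: m_iff)
    have "(\<Sum>k=m..N. c k * h k)
        = (\<Sum>k=m..N. if prime k then prime_weight k / real k else 0) - 3 / 4 * (\<Sum>k=m..N. h k / real k)"
      unfolding sum_distrib_left sum_subtractf[symmetric]
    proof (rule sum.cong)
      fix k assume "k \<in> {m..N}"
      thus "c k * h k = (if prime k then prime_weight k / real k else 0) - 3 / 4 * (h k / real k)"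
        using ln_pos[of k] by (auto simp: c_def h_def prime_weight_def field_simps)
    qed simp
    also have "(\<Sum>k=m..N. if prime k then prime_weight k / real k else 0) = mean_weight N"
      unfolding mean_weight_def
      by (rule sum.mono_neutral_cong_right) (auto simp: large_primes_def m_iff)
    finally have "3 / 4 * (\<Sum>k=m..N. h k / real k) - K * h m \<le> mean_weight N"
      using main[of N] by simp
    moreover have "(log_size (Suc N))\<^sup>2 / 2 - (log_size m)\<^sup>2 / 2 \<le> (\<Sum>k=m..N. h k / real k)"
      using N
    proof (induction N rule: nat_induct_at_least)
      case base
      show ?case using log_size_square_increment[of m] m_iff[of m] by (simp add: h_def)
    next
      case (Suc n)
      have "(log_size (Suc (Suc n)))\<^sup>2 / 2 - (log_size (Suc n))\<^sup>2 / 2 \<le> h (Suc n) / real (Suc n)"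
        unfolding h_def using Suc.hyps m_iff[of "Suc n"] by (intro log_size_square_increment) simp
      thus ?case using Suc by (simp add: sum.nat_ivl_Suc')
    qed
    moreover have "(log_size N)\<^sup>2 \<le> (log_size (Suc N))\<^sup>2"
    proof (rule power_mono)
      show "0 \<le> log_size N" using ln_chain_length(3)[of N] N by (simp add: m_iff)
      show "log_size N \<le> log_size (Suc N)" using ln_pos[OF N] ln_pos[of "Suc N"] N m1 by (simp add: log_size_def)
    qed
    ultimately show "3 / 8 * (log_size N)\<^sup>2 - (\<bar>K * h m\<bar> + 3 / 8 * (log_size m)\<^sup>2) \<le> mean_weight N"
      by (simp add: abs_if split: if_splits)
  qed simp
qed

section \<open>Concentration of the weight\<close>

lemma card_multiples: "card {n \<in> {1..N}. d dvd n} = (if d = 0 then 0 else N div d)"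
proof (cases "d = 0")
  case False
  have "{n \<in> {1..N}. d dvd n} = (\<lambda>k. d * k) ` {1..N div d}"
    using False by (auto simp: less_eq_div_iff_mult_less_eq mult.commute Suc_le_eq elim!: dvdE)
  moreover have "inj_on (\<lambda>k. d * k) {1..N div d}" using False by (auto simp: inj_on_def)
  ultimately show ?thesis using False by (simp add: card_image)
qed auto

lemma card_multiples_le: "real (card {n \<in> {1..N}. d dvd n}) \<le> real N / real d"
  unfolding card_multiples using of_nat_div_le_of_nat[of N d, where ?'a = real] by simp

lemma card_multiples_ge:
  assumes "d > 0"
  shows "real N / real d - 1 \<le> real (card {n \<in> {1..N}. d dvd n})"
proof -
  have "N < d * (N div d + 1)" using assms dividend_less_times_div[of d N] by (simp add: algebra_simps)
  hence "real N < real d * real (N div d + 1)" by (metis of_nat_less_iff of_nat_mult)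
  thus ?thesis unfolding card_multiples using assms by (simp add: field_simps)
qed

text \<open>
The second moment of an additive function around the sum \<open>B\<close>, computed by expanding the square:
divisibility by distinct primes is independent up to rounding. The rounding in the mean costs
\<open>2 * B * (\<Sum>p\<in>Q. w p)\<close>, while in the second moment it has a favourable sign.
\<close>

lemma turan_kubilius:
  fixes w :: "nat \<Rightarrow> real"
  assumes fin: "finite Q" and Q: "\<And>p. p \<in> Q \<Longrightarrow> prime p" and w: "\<And>p. p \<in> Q \<Longrightarrow> 0 \<le> w p"
  defines "B \<equiv> \<Sum>p\<in>Q. w p / real p"
  shows "(\<Sum>n=1..N. ((\<Sum>p | p \<in> Q \<and> p dvd n. w p) - B)\<^sup>2)
    \<le> real N * (\<Sum>p\<in>Q. (w p)\<^sup>2 / real p) + 2 * B * (\<Sum>p\<in>Q. w p)"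
proof -
  define F where "F = (\<lambda>n. \<Sum>p\<in>Q. w p * of_bool (p dvd n))"
  have F: "(\<Sum>p | p \<in> Q \<and> p dvd n. w p) = F n" for n
    unfolding F_def using fin by (intro sum.mono_neutral_cong_left) auto
  have cnt: "(\<Sum>n=1..N. of_bool (P n)) = real (card {n \<in> {1..N}. P n})" for P
    by (simp add: of_bool_def sum.If_cases Int_def)
  have "B \<ge> 0" unfolding B_def using w by (intro sum_nonneg) auto
  have first: "real N * B - (\<Sum>p\<in>Q. w p) \<le> (\<Sum>n=1..N. F n)"
  proof -
    have "real N * B - (\<Sum>p\<in>Q. w p) = (\<Sum>p\<in>Q. w p * (real N / real p - 1))"
      unfolding B_def by (simp add: sum_distrib_left algebra_simps sum_subtractf)
    also have "\<dots> \<le> (\<Sum>p\<in>Q. w p * real (card {n \<in> {1..N}. p dvd n}))"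
      using Q w by (intro sum_mono mult_left_mono card_multiples_ge prime_gt_0_nat)
    also have "\<dots> = (\<Sum>p\<in>Q. \<Sum>n=1..N. w p * of_bool (p dvd n))"
      by (simp only: cnt sum_distrib_left[symmetric])
    also have "\<dots> = (\<Sum>n=1..N. F n)" unfolding F_def by (rule sum.swap)
    finally show ?thesis .
  qed
  have second: "(\<Sum>n=1..N. (F n)\<^sup>2) \<le> real N * B\<^sup>2 + real N * (\<Sum>p\<in>Q. (w p)\<^sup>2 / real p)"
  proof -
    have "(\<Sum>n=1..N. (F n)\<^sup>2) = (\<Sum>n=1..N. \<Sum>p\<in>Q. \<Sum>q\<in>Q. w p * w q * of_bool (p dvd n \<and> q dvd n))"
      unfolding F_def power2_eq_square sum_product by (intro sum.cong) auto
    also have "\<dots> = (\<Sum>p\<in>Q. \<Sum>q\<in>Q. w p * w q * real (card {n \<in> {1..N}. p dvd n \<and> q dvd n}))"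
      by (subst sum.swap, rule sum.cong, simp, subst sum.swap)
        (simp only: cnt sum_distrib_left[symmetric])
    also have "\<dots> \<le> (\<Sum>p\<in>Q. \<Sum>q\<in>Q. real N * (w p / real p * (w q / real q))
        + (if p = q then real N * ((w p)\<^sup>2 / real p) else 0))"
    proof (intro sum_mono)
      fix p q assume pq: "p \<in> Q" "q \<in> Q"
      have ww: "0 \<le> w p * w q" using w pq by simp
      show "w p * w q * real (card {n \<in> {1..N}. p dvd n \<and> q dvd n})
          \<le> real N * (w p / real p * (w q / real q)) + (if p = q then real N * ((w p)\<^sup>2 / real p) else 0)"
      proof (cases "p = q")
        case True
        have "w p * w q * real (card {n \<in> {1..N}. p dvd n}) \<le> w p * w q * (real N / real p)"
          using ww by (intro mult_left_mono card_multiples_le)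
        also have "\<dots> = real N * ((w p)\<^sup>2 / real p)" using True by (simp add: power2_eq_square)
        finally have "w p * w q * real (card {n \<in> {1..N}. p dvd n \<and> q dvd n})
          \<le> real N * ((w p)\<^sup>2 / real p)" using True by simp
        moreover have "0 \<le> real N * (w p / real p * (w q / real q))" using w pq by simp
        ultimately show ?thesis unfolding if_P[OF True] by linarith
      next
        case False
        hence "coprime p q" using Q pq by (simp add: primes_coprime)
        hence "{n \<in> {1..N}. p dvd n \<and> q dvd n} = {n \<in> {1..N}. p * q dvd n}"
          by (auto intro: divides_mult dvd_mult_left dvd_mult_right)
        moreover have "w p * w q * real (card {n \<in> {1..N}. p * q dvd n}) \<le> w p * w q * (real N / real (p * q))"
          using ww by (intro mult_left_mono card_multiples_le)
        ultimately show ?thesis using False by (simp add: algebra_simps)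
      qed
    qed
    also have "\<dots> = real N * B\<^sup>2 + real N * (\<Sum>p\<in>Q. (w p)\<^sup>2 / real p)"
      unfolding B_def power2_eq_square[of "sum _ _"] sum_product
      using fin by (simp add: sum.distrib sum_distrib_left)
    finally show ?thesis .
  qed
  have "(\<Sum>n=1..N. (F n - B)\<^sup>2) = (\<Sum>n=1..N. (F n)\<^sup>2) - 2 * B * (\<Sum>n=1..N. F n) + real N * B\<^sup>2"
    by (simp add: power2_diff sum.distrib sum_subtractf sum_distrib_left algebra_simps)
  also have "\<dots> \<le> (real N * B\<^sup>2 + real N * (\<Sum>p\<in>Q. (w p)\<^sup>2 / real p))
      - 2 * B * (real N * B - (\<Sum>p\<in>Q. w p)) + real N * B\<^sup>2"
    using first second \<open>B \<ge> 0\<close> mult_left_mono[OF first, of "2 * B"] by linarith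
  finally show ?thesis by (simp add: F power2_eq_square algebra_simps)
qed

lemma weight_eq:
  assumes "1 \<le> n" "n \<le> N"
  shows "weight n = (\<Sum>p | p \<in> large_primes N \<and> p dvd n. prime_weight p)"
  unfolding weight_def using assms
  by (intro sum.cong) (auto simp: large_primes_def dest: dvd_imp_le)

lemma prime_weight_bounds:
  assumes "p \<in> large_primes N"
  shows "0 \<le> prime_weight p" "prime_weight p \<le> ln (ln (real N))"
proof -
  have p: "exp (exp 3) \<le> real p" "p \<le> N" using assms by (auto simp: large_primes_def)
  have p1: "1 < real p" using p(1) by (rule less_le_trans[rotated]) simp
  have s: "1 \<le> log_size p" using ln_chain_length(3)[OF p(1)] .
  have chi: "0 \<le> (3 + chi4 p) / 4" "(3 + chi4 p) / 4 \<le> 1" by (auto simp: chi4_def)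
  show "0 \<le> prime_weight p" unfolding prime_weight_def using chi s by simp
  have "prime_weight p \<le> 1 * log_size p"
    unfolding prime_weight_def using chi s by (intro mult_right_mono) auto
  also have "\<dots> \<le> ln (ln (real p))" by (simp add: log_size_def)
  also have "\<dots> \<le> ln (ln (real N))" using p p1 by simp
  finally show "prime_weight p \<le> ln (ln (real N))" .
qed

text \<open>
Chebyshev's inequality. All weights are at most \<open>L = ln (ln N)\<close>, so the second moment is at most
\<open>3 * N * L * B\<close> with \<open>B = mean_weight N\<close>; even the crude bound \<open>N * L\<close> for the sum of the weights
over all primes up to \<open>N\<close> is good enough, because the main term has the same size.
\<close>

lemma card_small_weight:
  assumes N: "exp (exp 3) \<le> real N" and "0 < \<eta>" and B: "0 < mean_weight N"
  shows "real (card {n \<in> {1..N}. weight n < (1 - \<eta>) * mean_weight N})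
    \<le> 3 * real N * ln (ln (real N)) / (\<eta>\<^sup>2 * mean_weight N)"
proof -
  define L where "L = ln (ln (real N))"
  define B where "B = mean_weight N"
  define Q where "Q = large_primes N"
  define bad where "bad = {n \<in> {1..N}. weight n < (1 - \<eta>) * B}"
  have B0: "B > 0" using B by (simp add: B_def)
  have wb: "0 \<le> prime_weight p" "prime_weight p \<le> L" if "p \<in> Q" for p
    using prime_weight_bounds that by (auto simp: Q_def L_def)
  have "real (card bad) * (\<eta> * B)\<^sup>2 = (\<Sum>n\<in>bad. (\<eta> * B)\<^sup>2)" by simp
  also have "\<dots> \<le> (\<Sum>n\<in>bad. (weight n - B)\<^sup>2)"
  proof (rule sum_mono)
    fix n assume "n \<in> bad"
    hence "\<eta> * B \<le> B - weight n" by (simp add: bad_def algebra_simps)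
    hence "(\<eta> * B)\<^sup>2 \<le> (B - weight n)\<^sup>2" using B0 assms(2) by (intro power_mono) auto
    thus "(\<eta> * B)\<^sup>2 \<le> (weight n - B)\<^sup>2" by (simp add: power2_commute)
  qed
  also have "\<dots> \<le> (\<Sum>n=1..N. (weight n - B)\<^sup>2)"
    by (intro sum_mono2) (auto simp: bad_def)
  also have "\<dots> = (\<Sum>n=1..N. ((\<Sum>p | p \<in> Q \<and> p dvd n. prime_weight p) - B)\<^sup>2)"
    by (intro sum.cong) (auto simp: Q_def weight_eq)
  also have "\<dots> \<le> real N * (\<Sum>p\<in>Q. (prime_weight p)\<^sup>2 / real p) + 2 * B * (\<Sum>p\<in>Q. prime_weight p)"
    unfolding B_def mean_weight_def Q_def[symmetric]
    by (rule turan_kubilius) (auto simp: wb, auto simp: Q_def large_primes_def)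
  also have "\<dots> \<le> real N * (L * B) + 2 * B * (real N * L)"
  proof (intro add_mono mult_left_mono)
    have "(\<Sum>p\<in>Q. (prime_weight p)\<^sup>2 / real p) \<le> (\<Sum>p\<in>Q. L * (prime_weight p / real p))"
      unfolding power2_eq_square times_divide_eq_right
      using wb by (intro sum_mono divide_right_mono mult_right_mono) auto
    thus "(\<Sum>p\<in>Q. (prime_weight p)\<^sup>2 / real p) \<le> L * B"
      by (simp add: B_def mean_weight_def Q_def sum_distrib_left)
    have "(\<Sum>p\<in>Q. prime_weight p) \<le> real (card Q) * L"
      using wb by (intro sum_bounded_above) auto
    also have "Q \<subseteq> {1..N}" by (auto simp: Q_def large_primes_def prime_ge_Suc_0_nat)
    hence "card Q \<le> N" using card_mono[of "{1..N}" Q] by simp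
    hence "real (card Q) * L \<le> real N * L"
      using ln_chain_length(3)[OF N] by (intro mult_right_mono) (auto simp: L_def log_size_def)
    finally show "(\<Sum>p\<in>Q. prime_weight p) \<le> real N * L" .
  qed (use B0 in auto)
  finally have "real (card bad) * (\<eta> * B)\<^sup>2 \<le> 3 * real N * L * B" by (simp add: algebra_simps)
  hence "real (card bad) * (\<eta>\<^sup>2 * B) * B \<le> (3 * real N * L) * B"
    by (simp add: power2_eq_square algebra_simps)
  hence "real (card bad) * (\<eta>\<^sup>2 * B) \<le> 3 * real N * L" using B0 by simp
  thus ?thesis using B0 assms(2) by (simp add: bad_def B_def L_def field_simps)
qed

section \<open>The asymptotic bound on a set of density one\<close>

lemma for_almost_allI:
  fixes e :: "nat \<Rightarrow> real"
  assumes "e \<longlonglongrightarrow> 0"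
    and "\<forall>\<^sub>F N in sequentially. real (card {n \<in> {m..N}. \<not> P n}) \<le> real N * e N"
  shows "for_almost_all P"
proof -
  define M where "M = {n. 1 \<le> n \<and> m \<le> n \<and> P n}"
  have "(\<lambda>N. real (card (M \<inter> {1..N})) / real N) \<longlonglongrightarrow> 1"
  proof (rule tendsto_sandwich)
    show "(\<lambda>N. 1 - real m / real N - e N) \<longlonglongrightarrow> 1"
    proof -
      have "(\<lambda>N. real m / real N) \<longlonglongrightarrow> 0" by real_asymp
      from tendsto_diff[OF tendsto_diff[OF tendsto_const[of 1] this] assms(1)] show ?thesis by simp
    qed
    show "\<forall>\<^sub>F N in sequentially. 1 - real m / real N - e N \<le> real (card (M \<inter> {1..N})) / real N"
      using assms(2) eventually_gt_at_top[of 0]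
    proof eventually_elim
      case (elim N)
      have "{1..N} \<subseteq> (M \<inter> {1..N}) \<union> ({..<m} \<union> {n \<in> {m..N}. \<not> P n})" by (auto simp: M_def)
      hence "card {1..N} \<le> card ((M \<inter> {1..N}) \<union> ({..<m} \<union> {n \<in> {m..N}. \<not> P n}))"
        by (intro card_mono) auto
      also have "\<dots> \<le> card (M \<inter> {1..N}) + (card {..<m} + card {n \<in> {m..N}. \<not> P n})"
        by (meson card_Un_le add_left_mono order.trans)
      finally have "real N \<le> real (card (M \<inter> {1..N})) + real m + real N * e N"
        using elim(1) by simp
      moreover have "(1 - real m / real N - e N) * real N = real N - real m - real N * e N"
        using elim(2) by (simp add: left_diff_distrib)
      ultimately show ?case using elim(2) by (subst pos_le_divide_eq) auto
    qed
    show "\<forall>\<^sub>F N in sequentially. real (card (M \<inter> {1..N})) / real N \<le> 1"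
      using eventually_gt_at_top[of 0]
    proof eventually_elim
      case (elim N)
      have "card (M \<inter> {1..N}) \<le> N" using card_mono[of "{1..N}" "M \<inter> {1..N}"] by simp
      thus ?case using elim by simp
    qed
  qed simp
  hence "(\<lambda>N. ereal (real (card (M \<inter> {1..N})) / real N)) \<longlonglongrightarrow> 1"
    by (simp add: one_ereal_def)
  hence "lower_density M = 1"
    unfolding lower_density_def by (intro lim_imp_Liminf) auto
  moreover have "M \<subseteq> {1..}" "\<forall>n\<in>M. P n" by (auto simp: M_def)
  ultimately show ?thesis unfolding for_almost_all_def by blast
qed

theorem theorem1p5:
  shows "\<exists>\<delta> :: nat \<Rightarrow> real. \<delta> \<longlonglongrightarrow> 0 \<and>
    for_almost_all (\<lambda>m. \<exists>A \<subseteq> carrier (Zmod m).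
      diff_set m A \<inter> squares_mod m = {\<zero>\<^bsub>Zmod m\<^esub>} \<and>
      real (card A) \<ge> exp (0.375 * (ln (ln (real m)))\<^sup>2 * (1 + \<delta> m)))"
proof -
  obtain C where C: "C \<ge> 0"
    "\<And>N. exp (exp 3) \<le> real N \<Longrightarrow> 3 / 8 * (log_size N)\<^sup>2 - C \<le> mean_weight N"
    using mean_weight_ge by blast
  define b where "b = (\<lambda>x :: real. 3 / 8 * (x - 2)\<^sup>2 - C)"
  \<comment> \<open>\<open>G L\<close> bounds the weight of a typical integer from below, \<open>d\<close> is
    the error term it leaves.\<close>
  define G where "G = (\<lambda>x :: real. (1 - x powr (-1/4)) * b x)"
  define d where "d = (\<lambda>x :: real. (G x - x / 2) / (0.375 * x\<^sup>2) - 1)"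
  have lim: "filterlim (\<lambda>m. ln (ln (real m))) at_top sequentially" by real_asymp
  have "(d \<longlongrightarrow> 0) at_top" unfolding d_def G_def b_def by real_asymp
  hence d0: "(\<lambda>m. d (ln (ln (real m)))) \<longlonglongrightarrow> 0" using filterlim_compose lim by blast
  \<comment> \<open>A bound for the proportion of exceptional integers, from Chebyshev's inequality with relative error
    \<open>L powr (-1/4)\<close>: small enough to be absorbed, large enough for \<open>e\<close> to
    vanish.\<close>
  define e where "e = (\<lambda>x :: real. 3 * x / ((x powr (-1/4))\<^sup>2 * b x))"
  have "(e \<longlongrightarrow> 0) at_top" unfolding e_def b_def by real_asymp
  hence e0: "(\<lambda>m. e (ln (ln (real m)))) \<longlonglongrightarrow> 0" using filterlim_compose lim by blast
  \<comment> \<open>From \<open>x0\<close> on, \<open>b\<close> is positive.\<close>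
  define x0 where "x0 = 3 + 8 / 3 * C"
  have b_pos: "b x > 0" if "x \<ge> x0" for x
  proof -
    have "1 + 8 / 3 * C \<le> x - 2" using that by (simp add: x0_def)
    hence "(1 + 8 / 3 * C)\<^sup>2 \<le> (x - 2)\<^sup>2" using C(1) by (intro power_mono) auto
    moreover have "1 + 8 / 3 * C \<le> (1 + 8 / 3 * C)\<^sup>2" using C(1) by (intro self_le_power) auto
    ultimately show ?thesis by (simp add: b_def)
  qed
  \<comment> \<open>Typical integers up to \<open>N\<close> satisfy a bound in terms of \<open>N\<close>; by
    monotonicity it implies the bound in terms of the integer itself.\<close>
  have G_mono: "G x \<le> G y" if "x0 \<le> x" "x \<le> y" for x y
    unfolding G_def
  proof (rule mult_mono)
    have x: "x \<ge> 3" using that C(1) by (simp add: x0_def)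
    show "1 - x powr (-1/4) \<le> 1 - y powr (-1/4)" using x that by (simp add: powr_mono2')
    show "b x \<le> b y" using x that by (auto simp: b_def intro!: power_mono)
    show "0 \<le> b x" using b_pos that by force
    have "y powr (-1/4) \<le> 1 powr (-1/4)" using x that by (intro powr_mono2') auto
    thus "0 \<le> 1 - y powr (-1/4)" by simp
  qed
  have "\<forall>\<^sub>F m in sequentially. exp (exp 3) \<le> real m \<and> x0 \<le> ln (ln (real m))"
    using lim by (intro eventually_conj) (real_asymp, simp add: filterlim_at_top)
  then obtain m0 where m0: "\<And>m. m \<ge> m0 \<Longrightarrow> exp (exp 3) \<le> real m \<and> x0 \<le> ln (ln (real m))"
    unfolding eventually_sequentially by blast
  define P where "P = (\<lambda>m. \<exists>A \<subseteq> carrier (Zmod m).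
      diff_set m A \<inter> squares_mod m = {\<zero>\<^bsub>Zmod m\<^esub>} \<and>
      real (card A) \<ge> exp (0.375 * (ln (ln (real m)))\<^sup>2 * (1 + d (ln (ln (real m))))))"
  have "for_almost_all P"
  proof (rule for_almost_allI[OF e0])
    show "\<forall>\<^sub>F N in sequentially. real (card {n \<in> {m0..N}. \<not> P n}) \<le> real N * e (ln (ln (real N)))"
      using eventually_ge_at_top[of m0]
    proof eventually_elim
      case (elim N)
      define L where "L = ln (ln (real N))"
      have N: "exp (exp 3) \<le> real N" and L: "x0 \<le> L" using m0[OF elim] by (auto simp: L_def)
      have L3: "L \<ge> 3" using L C(1) by (simp add: x0_def)
      have bB: "b L \<le> mean_weight N" using C(2)[OF N] by (simp add: b_def L_def log_size_def)
      have bL: "b L > 0" using b_pos L by blast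
      have eta: "L powr (-1/4) > 0" "L powr (-1/4) \<le> 1"
        using L3 powr_mono2'[of "-1/4" 1 L] by auto
      have "P n" if n: "n \<in> {m0..N}" "(1 - L powr (-1/4)) * mean_weight N \<le> weight n" for n
      proof -
        define l where "l = ln (ln (real n))"
        have nn: "exp (exp 3) \<le> real n" "x0 \<le> l" using m0[of n] n by (auto simp: l_def)
        have n1: "real n > 1" using nn(1) by (rule less_le_trans[rotated]) simp
        have "l \<le> L" using n n1 by (simp add: l_def L_def)
        have l3: "l \<ge> 3" using nn C(1) by (simp add: x0_def)
        obtain k where k: "k \<ge> 1" "nonsquare_diffs_of_card n k" "weight n - l / 2 \<le> ln (real k)"
          using nonsquare_diffs_weight[OF nn(1)] by (auto simp: l_def)
        have "G l \<le> G L" using G_mono nn(2) \<open>l \<le> L\<close> by blast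
        also have "G L \<le> (1 - L powr (-1/4)) * mean_weight N"
          unfolding G_def using bB eta by (intro mult_left_mono) auto
        finally have "G l - l / 2 \<le> ln (real k)" using n(2) k(3) by linarith
        hence "exp (G l - l / 2) \<le> real k" using k(1) by (simp add: ln_ge_iff)
        moreover have "0.375 * l\<^sup>2 * (1 + d l) = G l - l / 2" using l3 by (simp add: d_def)
        ultimately have "exp (0.375 * l\<^sup>2 * (1 + d l)) \<le> real k" by (simp only:)
        moreover obtain A where "A \<subseteq> carrier (Zmod n)"
          "diff_set n A \<inter> squares_mod n = {\<zero>\<^bsub>Zmod n\<^esub>}" "card A = k"
          using nonsquare_diffs_imp_set[of n k] k n1 by auto
        ultimately show ?thesis unfolding P_def l_def[symmetric] by blast
      qed
      hence "{n \<in> {m0..N}. \<not> P n} \<subseteq> insert 0 {n \<in> {1..N}. weight n < (1 - L powr (-1/4)) * mean_weight N}"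
        by force
      moreover have "m0 \<noteq> 0" using m0[of 0] by (auto simp: not_le)
      ultimately have "{n \<in> {m0..N}. \<not> P n} \<subseteq> {n \<in> {1..N}. weight n < (1 - L powr (-1/4)) * mean_weight N}"
        by auto
      hence "card {n \<in> {m0..N}. \<not> P n} \<le> card {n \<in> {1..N}. weight n < (1 - L powr (-1/4)) * mean_weight N}"
        by (intro card_mono) auto
      also have "real (card {n \<in> {1..N}. weight n < (1 - L powr (-1/4)) * mean_weight N})
          \<le> 3 * real N * ln (ln (real N)) / ((L powr (-1/4))\<^sup>2 * mean_weight N)"
        using N eta bB bL by (intro card_small_weight) auto
      also have "\<dots> \<le> 3 * real N * L / ((L powr (-1/4))\<^sup>2 * b L)"
        unfolding L_def[symmetric] using L3 eta bB bL
        by (intro divide_left_mono mult_left_mono mult_pos_pos) auto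
      finally show ?case unfolding L_def[symmetric] by (simp add: e_def mult_ac)
    qed
  qed
  thus ?thesis using d0 unfolding P_def by blast
qed

end
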